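(* Let $r,N\ge1$, let $\lambda=(\lambda_1\ge\dots\ge\lambda_r\ge0)$ be a partition with $\lambda_1<N$, let $w_1,w_3\in S_r$, $\mathbf z=(z_1,\dots,z_r)$, and let $w_4\in S_r$ be arbitrary. Then $$Z\big(\mathcal S^{\mathrm{col}}_\lambda(w_1,w_3,\mathbf z)\big)=\sum_{w_2\in S_r}\tilde Z\big(\mathcal S(\lambda,w_1,w_2,w_3,w_4,\mathbf z)\big),$$ where $\tilde Z(\mathfrak S)=\Big(\prod_{i=1}^rz_i^{N(1-r)}\Big)Z(\mathfrak S)$ is the scaled partition function of a bicolored system $\mathfrak S$.
   Context: Colors are $\mathbf c=\{c_1<\dots<c_r\}$, dolors are $\mathbf d=\{d_1<\dots<d_r\}$; $w_0\in S_r$ is the long element; $t$ is a global parameter. The partition function $Z$ of a system is the sum over its states of the product of the weights of all fused vertices. Bicolored weights. An unfused vertex carries a color-dolor label $(c,d)$ and a parameter $z$. Its left and right (horizontal) edges each carry one element of $\mathbf c\cup\mathbf d$; its top and bottom edges each carry a number in $\mathbb N=\{0,1,2,\dots\}$. The admissible configurations and weights are: (1) left $=$ right $=x$ a dolor, top $=$ bottom $=n$: weight $1$ if $x=d$; if $x\ne d$, weight $z^{\epsilon}t^{\eta}$ with $\epsilon=1$ if $c=c_1$, else $0$, and $\eta=n$ if $x<d$, else $0$. (2) left $=$ right $=a$ a color, top $=$ bottom $=n$: weight $z$ if $a=c$; $t^n$ if $c>a$; $1$ if $c<a$. (3) left $=d$, right $=c$, top $=n\ge1$, bottom $=n-1$: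 weight $(1-t^n)/(1-t)=1+t+\dots+t^{n-1}$. (4) left $=c$, right $=d$, top $=n$, bottom $=n+1$: weight $(1-t)z$. All other configurations are inadmissible (weight $0$). Order pairs by: $(c,d)<(c',d')$ iff $d>d'$, or $d=d'$ and $c<c'$. A fused vertex is a horizontal row of $r^2$ unfused vertices with the same parameter, one for each pair $(c,d)$, placed left to right in increasing order; vertical edges carry multiplicities in $\mathbb N^{\mathbf c\times\mathbf d}$. It is admissible if its internal horizontal edges can be labelled (then uniquely) so that all unfused vertices are admissible; its weight is the product of the unfused weights. Bicolored systems. $\mathcal S(\lambda,w_1,w_2,w_3,w_4,\mathbf z)$: grid of fused vertices with $r$ rows ($1,\dots,r$ top to bottom, row $i$ having parameter $z_i$) and $N$ columns ($N-1,\dots,0$ left to right). Right boundary of row $i$: color $c_{w_1^{-1}(i)}$; left boundary of row $i$: dolor $d_{w_2^{-1}(i)}$; top boundary: for each $i$ one boson $(c_{w_3^{-1}(i)},d_{w_4^{-1}w_0(i)})$ in column $\lambda_i$ and nothing else; bottom boundary empty. A state assigns spins to all edges, compatibly with the boundary, so that all fused vertices are admissible. Colored model (of Bump and Naprienko; equivalently the bicolored model with one dolor, renamed $+$). A fused colored vertex is a row of $r$ unfused vertices labelled $c_1,\dots,c_r$ left to right; horizontal spins in $\mathbf c\cup\{+\}$, vertical spins in $\mathbb N^{\mathbf c}$. Unfused weights for label $c$, parameter $z$: left $=$ right $=+$, top $=$ bottom $=n$: $1$; left $=$ right $=a\in\mathbf c$, top $=$ bottom $=n$: $z$ if $a=c$,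 $t^n$ if $c>a$, $1$ if $c<a$; left $=+$, right $=c$, top $=n\ge1$, bottom $=n-1$: $(1-t^n)/(1-t)$; left $=c$, right $=+$, top $=n$, bottom $=n+1$: $(1-t)z$; others inadmissible. Fused weights are products, as before. $\mathcal S^{\mathrm{col}}_\lambda(w_1,w_3,\mathbf z)$: same grid; right boundary of row $i$ is $c_{w_1^{-1}(i)}$; left boundary edges are all $+$; top boundary has, for each $i$, one particle of color $c_{w_3^{-1}(i)}$ in column $\lambda_i$; bottom boundary empty. *)

theory Defs
  imports Complex_Main "HOL-Library.FuncSet" "HOL-Combinatorics.Permutations"
begin

text \<open>
  Both models are instances of one kind of system of fused vertices, given by
  \<^item> an unfused weight \<open>U z l x y m n\<close> for parameter \<open>z\<close>, label \<open>l\<close>, left and right spins \<open>x\<close>, \<open>y\<close>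
    and top and bottom multiplicities \<open>m\<close>, \<open>n\<close>, with value \<open>None\<close> on inadmissible configurations;
  \<^item> the list \<open>L\<close> of labels of the unfused vertices of a fused vertex, from left to right;
  \<^item> the set \<open>H\<close> of horizontal spins.
  Colors, dolors and rows are numbered by \<open>{1..r}\<close>.
\<close>

type_synonym ('a, 'l, 'h) unfused = "'a \<Rightarrow> 'l \<Rightarrow> 'h \<Rightarrow> 'h \<Rightarrow> nat \<Rightarrow> nat \<Rightarrow> 'a option"

text \<open>\<open>gs\<close> lists the spins on all horizontal edges of the fused vertex, outer edges included.\<close>

definition fused_labelling ::
  "('a, 'l, 'h) unfused \<Rightarrow> 'l list \<Rightarrow> 'h set \<Rightarrow> 'a \<Rightarrow> 'h \<Rightarrow> 'h \<Rightarrow> ('l \<Rightarrow> nat) \<Rightarrow> ('l \<Rightarrow> nat) \<Rightarrow> 'h list \<Rightarrow> bool"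
where
  "fused_labelling U L H z left right T B gs \<longleftrightarrow>
     length gs = Suc (length L) \<and> set gs \<subseteq> H \<and> gs ! 0 = left \<and> gs ! length L = right \<and>
     (\<forall>k<length L. U z (L ! k) (gs ! k) (gs ! Suc k) (T (L ! k)) (B (L ! k)) \<noteq> None)"

definition fused_admissible ::
  "('a, 'l, 'h) unfused \<Rightarrow> 'l list \<Rightarrow> 'h set \<Rightarrow> 'a \<Rightarrow> 'h \<Rightarrow> 'h \<Rightarrow> ('l \<Rightarrow> nat) \<Rightarrow> ('l \<Rightarrow> nat) \<Rightarrow> bool"
where
  "fused_admissible U L H z left right T B \<longleftrightarrow>
     (\<exists>gs. fused_labelling U L H z left right T B gs)"

text \<open>Meaningful for admissible fused vertices only. In both models below the labelling is unique,
  as an unfused weight is admissible for at most one right spin once the other spins are given.\<close>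

definition fused_weight ::
  "('a::field, 'l, 'h) unfused \<Rightarrow> 'l list \<Rightarrow> 'h set \<Rightarrow> 'a \<Rightarrow> 'h \<Rightarrow> 'h \<Rightarrow> ('l \<Rightarrow> nat) \<Rightarrow> ('l \<Rightarrow> nat) \<Rightarrow> 'a"
where
  "fused_weight U L H z left right T B =
     (let gs = (THE gs. fused_labelling U L H z left right T B gs)
      in \<Prod>k<length L. the (U z (L ! k) (gs ! k) (gs ! Suc k) (T (L ! k)) (B (L ! k))))"

text \<open>
  Rows are \<open>1, \<dots>, r\<close> from top to bottom and columns \<open>N - 1, \<dots>, 0\<close> from left to right. In a state
  \<open>(h, v)\<close>, \<open>h (i, Suc j)\<close> and \<open>h (i, j)\<close> are the spins to the left and right of the fused vertex in row
  \<open>i\<close> and column \<open>j\<close>, and \<open>v (i - 1, j)\<close> and \<open>v (i, j)\<close> are those above and below it. All functions are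
  extensional, so that distinct elements of the set below are distinct states. In both models below
  the set is finite, since a multiplicity grows by at most one from one row to the next.
\<close>

definition states ::
  "('a, 'l, 'h) unfused \<Rightarrow> 'l list \<Rightarrow> 'h set \<Rightarrow> nat \<Rightarrow> nat \<Rightarrow> (nat \<Rightarrow> 'a) \<Rightarrow>
   (nat \<Rightarrow> 'h) \<Rightarrow> (nat \<Rightarrow> 'h) \<Rightarrow> (nat \<Rightarrow> 'l \<Rightarrow> nat) \<Rightarrow>
   ((nat \<times> nat \<Rightarrow> 'h) \<times> (nat \<times> nat \<Rightarrow> 'l \<Rightarrow> nat)) set"
where
  "states U L H r N z left right T =
     {(h, v). h \<in> {1..r} \<times> {0..N} \<rightarrow>\<^sub>E H \<and>
        v \<in> {0..r} \<times> {..<N} \<rightarrow>\<^sub>E (set L \<rightarrow>\<^sub>E UNIV) \<and>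
        (\<forall>i\<in>{1..r}. h (i, N) = left i \<and> h (i, 0) = right i) \<and>
        (\<forall>j<N. \<forall>l\<in>set L. v (0, j) l = T j l \<and> v (r, j) l = 0) \<and>
        (\<forall>i\<in>{1..r}. \<forall>j<N.
           fused_admissible U L H (z i) (h (i, Suc j)) (h (i, j)) (v (i - 1, j)) (v (i, j)))}"

definition partition_function ::
  "('a::field, 'l, 'h) unfused \<Rightarrow> 'l list \<Rightarrow> 'h set \<Rightarrow> nat \<Rightarrow> nat \<Rightarrow> (nat \<Rightarrow> 'a) \<Rightarrow>
   (nat \<Rightarrow> 'h) \<Rightarrow> (nat \<Rightarrow> 'h) \<Rightarrow> (nat \<Rightarrow> 'l \<Rightarrow> nat) \<Rightarrow> 'a"
where
  "partition_function U L H r N z left right T =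
     (\<Sum>(h, v)\<in>states U L H r N z left right T.
        \<Prod>i\<in>{1..r}. \<Prod>j<N.
          fused_weight U L H (z i) (h (i, Suc j)) (h (i, j)) (v (i - 1, j)) (v (i, j)))"

definition long_element :: "nat \<Rightarrow> nat \<Rightarrow> nat" where
  "long_element r i = (if i \<in> {1..r} then r + 1 - i else i)"


datatype bi_spin = Color nat | Dolor nat

text \<open>In the third clause \<open>1 + t + \<dots> + t ^ (m - 1)\<close> stands for \<open>(1 - t ^ m) / (1 - t)\<close>, to include \<open>t = 1\<close>.\<close>

fun bi_unfused :: "'a::field \<Rightarrow> ('a, nat \<times> nat, bi_spin) unfused" where
  "bi_unfused t z (c, d) (Dolor x) (Dolor y) m n =
     (if x = y \<and> m = n
      then Some (if x = d then 1 else z ^ (if c = 1 then 1 else 0) * t ^ (if x < d then n else 0))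
      else None)"
| "bi_unfused t z (c, d) (Color a) (Color b) m n =
     (if a = b \<and> m = n then Some (if a = c then z else if c > a then t ^ n else 1) else None)"
| "bi_unfused t z (c, d) (Dolor x) (Color a) m n =
     (if x = d \<and> a = c \<and> m \<ge> 1 \<and> n = m - 1 then Some (\<Sum>k<m. t ^ k) else None)"
| "bi_unfused t z (c, d) (Color a) (Dolor x) m n =
     (if a = c \<and> x = d \<and> n = m + 1 then Some ((1 - t) * z) else None)"

text \<open>All pairs \<open>(c, d)\<close> in increasing order, where \<open>(c, d) < (c', d')\<close> iff \<open>d > d'\<close>, or \<open>d = d'\<close> and \<open>c < c'\<close>.\<close>

definition bi_labels :: "nat \<Rightarrow> (nat \<times> nat) list" where
  "bi_labels r = concat (map (\<lambda>d. map (\<lambda>c. (c, d)) [1..<Suc r]) (rev [1..<Suc r]))"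

definition bi_Z ::
  "'a::field \<Rightarrow> nat \<Rightarrow> nat \<Rightarrow> (nat \<Rightarrow> nat) \<Rightarrow>
   (nat \<Rightarrow> nat) \<Rightarrow> (nat \<Rightarrow> nat) \<Rightarrow> (nat \<Rightarrow> nat) \<Rightarrow> (nat \<Rightarrow> nat) \<Rightarrow> (nat \<Rightarrow> 'a) \<Rightarrow> 'a"
where
  "bi_Z t r N lam w1 w2 w3 w4 z =
     partition_function (bi_unfused t) (bi_labels r) (Color ` {1..r} \<union> Dolor ` {1..r}) r N z
       (\<lambda>i. Dolor (inv w2 i))
       (\<lambda>i. Color (inv w1 i))
       (\<lambda>j (c, d). card {i \<in> {1..r}. lam i = j \<and> inv w3 i = c \<and> inv w4 (long_element r i) = d})"

definition bi_scaled_Z ::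
  "'a::field \<Rightarrow> nat \<Rightarrow> nat \<Rightarrow> (nat \<Rightarrow> nat) \<Rightarrow>
   (nat \<Rightarrow> nat) \<Rightarrow> (nat \<Rightarrow> nat) \<Rightarrow> (nat \<Rightarrow> nat) \<Rightarrow> (nat \<Rightarrow> nat) \<Rightarrow> (nat \<Rightarrow> 'a) \<Rightarrow> 'a"
where
  "bi_scaled_Z t r N lam w1 w2 w3 w4 z =
     (\<Prod>i\<in>{1..r}. z i powi (int N * (1 - int r))) * bi_Z t r N lam w1 w2 w3 w4 z"


datatype col_spin = Particle nat | Plus

fun col_unfused :: "'a::field \<Rightarrow> ('a, nat, col_spin) unfused" where
  "col_unfused t z c Plus Plus m n = (if m = n then Some 1 else None)"
| "col_unfused t z c (Particle a) (Particle b) m n =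
     (if a = b \<and> m = n then Some (if a = c then z else if c > a then t ^ n else 1) else None)"
| "col_unfused t z c Plus (Particle a) m n =
     (if a = c \<and> m \<ge> 1 \<and> n = m - 1 then Some (\<Sum>k<m. t ^ k) else None)"
| "col_unfused t z c (Particle a) Plus m n =
     (if a = c \<and> n = m + 1 then Some ((1 - t) * z) else None)"

definition col_Z ::
  "'a::field \<Rightarrow> nat \<Rightarrow> nat \<Rightarrow> (nat \<Rightarrow> nat) \<Rightarrow> (nat \<Rightarrow> nat) \<Rightarrow> (nat \<Rightarrow> nat) \<Rightarrow> (nat \<Rightarrow> 'a) \<Rightarrow> 'a"
where
  "col_Z t r N lam w1 w3 z =
     partition_function (col_unfused t) [1..<Suc r] (Particle ` {1..r} \<union> {Plus}) r N z
       (\<lambda>i. Plus)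
       (\<lambda>i. Particle (inv w1 i))
       (\<lambda>j c. card {i \<in> {1..r}. lam i = j \<and> inv w3 i = c})"

end

theory Submission
  imports Defs
begin

text \<open>
  Forgetting dolors (a color becomes a particle, a dolor becomes \<open>+\<close>, and multiplicities are summed
  over the dolors) maps the bicolored model to the colored one, and this map is a lumping at every
  single fused vertex. If the right spin and the top configuration are fixed, the bicolored weights
  summed over all left spins and bottom configurations with given images equal \<open>z ^ (r - 1)\<close> times
  the colored weight; in particular the sum depends on the fixed spins only through their images.
  Eliminating the vertices of the grid one at a time, each after its left and lower neighbours,
  therefore turns a sum over all bicolored states above a colored state into the weight of the
  latter times \<open>\<Prod>i. z\<^sub>i ^ (N * (r - 1))\<close>. In this sum the left boundary dolors are arbitrary, but
  conservation of dolors kills all left boundaries other than the permutations.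

  At one fused vertex the path sums satisfy an explicit invariant: after the blocks of the dolors
  \<open>> d\<close>, a color or a dolor \<open>> d\<close> carries \<open>z ^ (r - d) / z\<close> times the colored weight for the
  multiplicities read so far. A dolor \<open>\<le> d\<close> carries \<open>z ^ (r - d) * t ^ n\<close>, with \<open>n\<close> the number of
  bosons read so far, if the left spin is a dolor, and \<open>0\<close> otherwise.
\<close>

subsection \<open>Fused weights as path sums\<close>

definition total_weight ::
  "('a::field, 'l, 'h) unfused \<Rightarrow> 'a \<Rightarrow> 'l \<Rightarrow> 'h \<Rightarrow> 'h \<Rightarrow> nat \<Rightarrow> nat \<Rightarrow> 'a"
where
  "total_weight U z l x y m n = (case U z l x y m n of None \<Rightarrow> 0 | Some w \<Rightarrow> w)"

lemma total_weight_nonzero: "total_weight U z l x y m n \<noteq> 0 \<Longrightarrow> U z l x y m n \<noteq> None"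
  by (cases "U z l x y m n") (auto simp: total_weight_def)

text \<open>\<open>fused_weight\<close> rests on a definite description and means nothing on an
  inadmissible vertex. With the value 0 there, products over the grid vanish off the states.\<close>

definition vertex_weight ::
  "('a::field, 'l, 'h) unfused \<Rightarrow> 'l list \<Rightarrow> 'h set \<Rightarrow> 'a \<Rightarrow> 'h \<Rightarrow> 'h \<Rightarrow> ('l \<Rightarrow> nat) \<Rightarrow> ('l \<Rightarrow> nat) \<Rightarrow> 'a"
where
  "vertex_weight U L H z x y T B =
     (if fused_admissible U L H z x y T B then fused_weight U L H z x y T B else 0)"

text \<open>An entry of an ordered product of transfer matrices, one matrix \<open>u l\<close> for
  each label.\<close>

fun path_sum :: "('l \<Rightarrow> 'h \<Rightarrow> 'h \<Rightarrow> 'a::field) \<Rightarrow> 'h set \<Rightarrow> 'l list \<Rightarrow> 'h \<Rightarrow> 'h \<Rightarrow> 'a" where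
  "path_sum u H [] x y = of_bool (x = y)"
| "path_sum u H (l # ls) x y = (\<Sum>g\<in>H. u l x g * path_sum u H ls g y)"

lemma path_sum_cong:
  assumes "\<And>l x y. l \<in> set ls \<Longrightarrow> u l x y = u' l x y"
  shows "path_sum u H ls x y = path_sum u' H ls x y"
  using assms by (induction ls arbitrary: x) (auto intro!: sum.cong)

text \<open>Associativity of the matrix product: the recursion removes the leftmost vertex, whereas
  the invariants below are propagated by adding vertices on the right.\<close>

lemma path_sum_snoc:
  assumes "finite H" "x \<in> H" "y \<in> H"
  shows "path_sum u H (ls @ [l]) x y = (\<Sum>g\<in>H. path_sum u H ls x g * u l g y)"
  using assms(2)
proof (induction ls arbitrary: x)
  case Nil
  have "(\<Sum>g\<in>H. u l x g * of_bool (g = y)) = u l x y"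
    using assms by (simp add: sum.delta' of_bool_def if_distrib cong: if_cong)
  moreover have "(\<Sum>g\<in>H. of_bool (x = g) * u l g y) = u l x y"
    using assms(1) Nil by (simp add: sum.delta of_bool_def if_distribR if_distrib cong: if_cong)
  ultimately show ?case by simp
next
  case (Cons a ls)
  have "path_sum u H ((a # ls) @ [l]) x y =
      (\<Sum>k\<in>H. \<Sum>g\<in>H. u a x k * path_sum u H ls k g * u l g y)"
    using Cons by (simp add: sum_distrib_left mult.assoc)
  also have "\<dots> = (\<Sum>g\<in>H. \<Sum>k\<in>H. u a x k * path_sum u H ls k g * u l g y)"
    by (rule sum.swap)
  finally show ?case by (simp add: sum_distrib_right)
qed

lemma fused_labelling_Cons:
  "fused_labelling U (l # ls) H z x y T B gs \<longleftrightarrow>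
     (\<exists>g gs'. gs = x # gs' \<and> x \<in> H \<and> U z l x g (T l) (B l) \<noteq> None \<and>
       fused_labelling U ls H z g y T B gs')"
proof (cases gs)
  case Nil
  then show ?thesis by (simp add: fused_labelling_def)
next
  case (Cons a gs')
  show ?thesis unfolding fused_labelling_def Cons
    by (auto simp: All_less_Suc2)
qed

lemma fused_labelling_Nil:
  "fused_labelling U [] H z x y T B gs \<longleftrightarrow> gs = [x] \<and> x \<in> H \<and> x = y"
  by (cases gs) (auto simp: fused_labelling_def)

lemma path_sum_nonzero_admissible:
  assumes "path_sum (\<lambda>l x y. total_weight U z l x y (T l) (B l)) H L x y \<noteq> 0" and "x \<in> H"
  shows "fused_admissible U L H z x y T B"
  using assms
proof (induction L arbitrary: x)
  case Nil
  then show ?case by (auto simp: fused_admissible_def fused_labelling_Nil)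
next
  case (Cons l ls)
  then obtain g where "g \<in> H" "total_weight U z l x g (T l) (B l) \<noteq> 0"
    "path_sum (\<lambda>l x y. total_weight U z l x y (T l) (B l)) H ls g y \<noteq> 0"
    by (auto elim!: sum.not_neutral_contains_not_neutral)
  moreover from this Cons.IH obtain gs where "fused_labelling U ls H z g y T B gs"
    by (auto simp: fused_admissible_def)
  ultimately show ?case
    using Cons.prems(2) total_weight_nonzero[of U z l x g "T l" "B l"]
    unfolding fused_admissible_def fused_labelling_Cons by blast
qed

text \<open>In both models an unfused weight is admissible for at most one bottom multiplicity, and this
  multiplicity is at most \<open>m + 1\<close>.\<close>

definition bottomless_weight ::
  "('a::field, 'l, 'h) unfused \<Rightarrow> 'a \<Rightarrow> 'l \<Rightarrow> 'h \<Rightarrow> 'h \<Rightarrow> nat \<Rightarrow> 'a"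
where
  "bottomless_weight U z l x y m = (\<Sum>n\<le>Suc m. total_weight U z l x y m n)"

text \<open>The unfused weights can be brought to this shape, with a condition \<open>P\<close> free
  of the bottom multiplicity; the bound on \<open>k\<close> keeps the only admissible value inside
  the range of the sum.\<close>

lemma bottomless_weight_eq:
  assumes "\<And>n. U z l x y m n = (if P \<and> n = k then Some w else None)" and "k \<le> Suc m"
  shows "bottomless_weight U z l x y m = (if P then w else 0)"
proof -
  have "total_weight U z l x y m n = (if n = k then if P then w else 0 else 0)" for n
    by (simp add: total_weight_def assms(1))
  then show ?thesis using assms(2) by (simp add: bottomless_weight_def)
qed

text \<open>Determinism from left to right gives the definite description in
  \<open>fused_weight\<close> its meaning and reduces each path sum over fixed vertical edges to a
  single term.\<close>

locale right_unique_weights =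
  fixes U :: "('a::field, 'l, 'h) unfused" and H :: "'h set"
  assumes finite_spins: "finite H"
    and right_unique: "U z l x y m n \<noteq> None \<Longrightarrow> U z l x y' m n \<noteq> None \<Longrightarrow> y = y'"
begin

lemma fused_labelling_unique:
  assumes "fused_labelling U L H z x y T B gs" "fused_labelling U L H z x y T B gs'"
  shows "gs = gs'"
  using assms
proof (induction L arbitrary: x gs gs')
  case Nil
  then show ?case by (simp add: fused_labelling_Nil)
next
  case (Cons l ls)
  then show ?case unfolding fused_labelling_Cons using right_unique by blast
qed

lemma path_sum_fused_labelling:
  assumes "fused_labelling U L H z x y T B gs"
  shows "path_sum (\<lambda>l x y. total_weight U z l x y (T l) (B l)) H L x y =
    (\<Prod>k<length L. the (U z (L ! k) (gs ! k) (gs ! Suc k) (T (L ! k)) (B (L ! k))))"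
  using assms
proof (induction L arbitrary: x gs)
  case Nil
  then show ?case by (simp add: fused_labelling_Nil)
next
  case (Cons l ls)
  then obtain g gs' where gs: "gs = x # gs'" "U z l x g (T l) (B l) \<noteq> None"
    "fused_labelling U ls H z g y T B gs'"
    unfolding fused_labelling_Cons by blast
  have "gs' ! 0 \<in> set gs'" using gs(3) by (intro nth_mem) (simp add: fused_labelling_def)
  with gs(3) have g: "g \<in> H" "gs' ! 0 = g" by (auto simp: fused_labelling_def)
  have 0: "total_weight U z l x g' (T l) (B l) = 0" if "g' \<noteq> g" for g'
    using right_unique[OF gs(2), of g'] that by (auto simp: total_weight_def split: option.split)
  let ?p = "path_sum (\<lambda>l x y. total_weight U z l x y (T l) (B l)) H ls"
  have "(\<Sum>g'\<in>H. total_weight U z l x g' (T l) (B l) * ?p g' y) =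
      (\<Sum>g'\<in>{g}. total_weight U z l x g' (T l) (B l) * ?p g' y)"
    using g 0 finite_spins by (intro sum.mono_neutral_right) auto
  then show ?case
    using Cons.IH[OF gs(3)] gs g
    by (auto simp: prod.lessThan_Suc_shift total_weight_def simp del: prod.lessThan_Suc)
qed

text \<open>On an admissible vertex the unique labelling is the one surviving path; on any other
  vertex a nonzero path sum would supply a labelling.\<close>

lemma vertex_weight_path_sum:
  assumes "x \<in> H"
  shows "vertex_weight U L H z x y T B =
    path_sum (\<lambda>l x y. total_weight U z l x y (T l) (B l)) H L x y"
proof (cases "fused_admissible U L H z x y T B")
  case True
  then obtain gs where gs: "fused_labelling U L H z x y T B gs"
    by (auto simp: fused_admissible_def)
  then have "(THE gs. fused_labelling U L H z x y T B gs) = gs"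
    using fused_labelling_unique by blast
  then show ?thesis
    using True path_sum_fused_labelling[OF gs] by (simp add: vertex_weight_def fused_weight_def)
next
  case False
  then show ?thesis using path_sum_nonzero_admissible assms by (fastforce simp: vertex_weight_def)
qed

end

text \<open>The local balances telescope along the row. With \<open>p\<close> and \<open>f\<close>
  left free the lemma covers colors, which move to the right, and dolors, which move to the left and
  get a negative \<open>p\<close>.\<close>

lemma path_sum_conservation:
  fixes p :: "'h \<Rightarrow> int" and f :: "'l \<Rightarrow> int"
  assumes "path_sum (\<lambda>l x y. total_weight U z l x y (T l) (B l)) H L x y \<noteq> 0"
    and "\<And>l x y m n. U z l x y m n \<noteq> None \<Longrightarrow> p y + f l * int n = p x + f l * int m"
  shows "p y + (\<Sum>l\<leftarrow>L. f l * int (B l)) = p x + (\<Sum>l\<leftarrow>L. f l * int (T l))"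
  using assms(1)
proof (induction L arbitrary: x)
  case Nil
  then show ?case by (auto split: if_splits)
next
  case (Cons l ls)
  then obtain g where g: "g \<in> H" "total_weight U z l x g (T l) (B l) \<noteq> 0"
    "path_sum (\<lambda>l x y. total_weight U z l x y (T l) (B l)) H ls g y \<noteq> 0"
    by (auto elim!: sum.not_neutral_contains_not_neutral)
  have "p g + f l * int (B l) = p x + f l * int (T l)"
    using total_weight_nonzero[OF g(2)] by (rule assms(2))
  with Cons.IH[OF g(3)] show ?case by simp
qed

text \<open>Colors are conserved in both models. Abstracting from labels and spins allows one fibre
  argument for the two; in the colored model \<open>color\<close> is the identity.\<close>

locale charged_weights = right_unique_weights U H
  for U :: "('a::field, 'l, 'h) unfused" and H :: "'h set" +
  fixes color :: "'l \<Rightarrow> 'c" and charge :: "'h \<Rightarrow> 'c option"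
  assumes charge_conserved: "U z l x y m n \<noteq> None \<Longrightarrow>
    of_bool (charge y = Some c) + of_bool (color l = c) * int n =
    of_bool (charge x = Some c) + of_bool (color l = c) * int m"
begin

lemma bottom_le:
  assumes "U z l x y m n \<noteq> None"
  shows "n \<le> Suc m"
  using charge_conserved[OF assms, of "color l"] by (auto simp: of_bool_def split: if_splits)

text \<open>The bottom multiplicities at distinct labels are independent, so the sum over
  \<open>B\<close> distributes over the products of unfused weights. By \<open>bottom_le\<close> the
  box contains every multiplicity that contributes.\<close>

lemma sum_bottoms:
  assumes "distinct ls"
  shows "(\<Sum>B\<in>(\<Pi>\<^sub>E l\<in>set ls. {..Suc (T l)}).
      path_sum (\<lambda>l x y. total_weight U z l x y (T l) (B l)) H ls x y) =
    path_sum (\<lambda>l x y. bottomless_weight U z l x y (T l)) H ls x y"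
  using assms
proof (induction ls arbitrary: x)
  case Nil
  then show ?case by simp
next
  case (Cons l ls)
  let ?P = "\<lambda>B. path_sum (\<lambda>l x y. total_weight U z l x y (T l) (B l)) H ls"
  let ?A = "\<Pi>\<^sub>E l\<in>set ls. {..Suc (T l)}"
  have "(\<Sum>B\<in>(\<Pi>\<^sub>E l\<in>set (l # ls). {..Suc (T l)}).
      path_sum (\<lambda>l x y. total_weight U z l x y (T l) (B l)) H (l # ls) x y) =
     (\<Sum>(n, B)\<in>{..Suc (T l)} \<times> ?A. path_sum (\<lambda>l' x y. total_weight U z l' x y (T l') ((B(l := n)) l')) H (l # ls) x y)"
    using Cons.prems inj_combinator[of l "set ls" "\<lambda>l. {..Suc (T l)}"]
    by (auto simp: PiE_insert_eq sum.reindex intro!: sum.cong simp del: path_sum.simps)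
  also have "\<dots> = (\<Sum>(n, B)\<in>{..Suc (T l)} \<times> ?A. \<Sum>g\<in>H. total_weight U z l x g (T l) n * ?P B g y)"
    using Cons.prems by (auto intro!: sum.cong path_sum_cong arg_cong[of _ _ "\<lambda>x. _ * x"])
  also have "\<dots> = (\<Sum>n\<le>Suc (T l). \<Sum>g\<in>H. \<Sum>B\<in>?A. total_weight U z l x g (T l) n * ?P B g y)"
    by (subst sum.cartesian_product[symmetric], intro sum.cong refl) (rule sum.swap)
  also have "\<dots> = (\<Sum>g\<in>H. \<Sum>n\<le>Suc (T l). \<Sum>B\<in>?A. total_weight U z l x g (T l) n * ?P B g y)"
    by (rule sum.swap)
  also have "\<dots> = (\<Sum>g\<in>H. bottomless_weight U z l x g (T l) * (\<Sum>B\<in>?A. ?P B g y))"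
    by (simp only: bottomless_weight_def sum_product)
  finally show ?case using Cons by simp
qed

lemma path_sum_bottom_le:
  assumes "path_sum (\<lambda>l x y. total_weight U z l x y (T l) (B l)) H L x y \<noteq> 0" and "l \<in> set L"
  shows "B l \<le> Suc (T l)"
  using assms
proof (induction L arbitrary: x)
  case (Cons l' ls)
  then obtain g where g: "g \<in> H" "total_weight U z l' x g (T l') (B l') \<noteq> 0"
    "path_sum (\<lambda>l x y. total_weight U z l x y (T l) (B l)) H ls g y \<noteq> 0"
    by (auto elim!: sum.not_neutral_contains_not_neutral)
  then have "B l' \<le> Suc (T l')" using bottom_le[OF total_weight_nonzero[OF g(2)]] by simp
  with Cons g show ?case by auto
qed simp

text \<open>Conservation determines the number of bosons of each color below the vertex from its
  other three sides. Prescribing these numbers as \<open>b\<close> therefore either costs nothing,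
  which leaves the unrestricted sum of \<open>sum_bottoms\<close>, or kills every term.
  \<open>C\<close> is described by membership only, to fit a fibre of \<open>merge_bottom\<close> as
  well as a single colored configuration.\<close>

lemma sum_vertex_weight_fiber:
  fixes L :: "'l list"
  defines "proj \<equiv> \<lambda>B c. \<Sum>l | l \<in> set L \<and> color l = c. B l"
  assumes L: "distinct L" "x \<in> H" and "finite C"
    and C: "\<And>B. B \<in> C \<longleftrightarrow> B \<in> extensional (set L) \<and> (\<forall>c\<in>color ` set L. proj B c = b c)"
  shows "(\<Sum>B\<in>C. vertex_weight U L H z x y T B) =
    (if \<forall>c\<in>color ` set L. of_bool (charge y = Some c) + b c = of_bool (charge x = Some c) + proj T c
     then path_sum (\<lambda>l x y. bottomless_weight U z l x y (T l)) H L x y else 0)"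
proof -
  let ?P = "\<lambda>B. path_sum (\<lambda>l x y. total_weight U z l x y (T l) (B l)) H L x y"
  have *: "of_bool (charge y = Some c) + proj B c = of_bool (charge x = Some c) + proj T c"
    if "?P B \<noteq> 0" for B c
  proof -
    have "(\<Sum>l\<leftarrow>L. of_bool (color l = c) * int (B l)) = int (proj B c)" for B
    proof -
      have "(\<Sum>l\<leftarrow>L. of_bool (color l = c) * int (B l)) = (\<Sum>l\<in>set L. if color l = c then int (B l) else 0)"
        unfolding sum_list_distinct_conv_sum_set[OF L(1)] by (intro sum.cong) auto
      then show ?thesis unfolding proj_def of_nat_sum by (subst sum.inter_filter) simp_all
    qed
    with path_sum_conservation[OF that, of "\<lambda>x. of_bool (charge x = Some c)" "\<lambda>l. of_bool (color l = c)"]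
      charge_conserved
    show ?thesis by (simp flip: of_nat_eq_iff[where ?'a=int])
  qed
  show ?thesis
  proof (cases "\<forall>c\<in>color ` set L. of_bool (charge y = Some c) + b c = of_bool (charge x = Some c) + proj T c")
    case True
    let ?A = "\<Pi>\<^sub>E l\<in>set L. {..Suc (T l)}"
    have "(\<Sum>B\<in>C. ?P B) = (\<Sum>B\<in>C \<inter> ?A. ?P B)"
    proof (intro sum.mono_neutral_right ballI)
      fix B assume B: "B \<in> C - C \<inter> ?A"
      then have "B \<in> extensional (set L)" using C by blast
      with B obtain l where "l \<in> set L" "\<not> B l \<le> Suc (T l)" by (auto simp: PiE_iff)
      with path_sum_bottom_le show "?P B = 0" by blast
    qed (use \<open>finite C\<close> in auto)
    \<comment> \<open>A box configuration outside \<open>C\<close> has the wrong number of bosons of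
      some color, so its path sum violates conservation unless it is 0.\<close>
    also have "\<dots> = (\<Sum>B\<in>?A. ?P B)"
    proof (intro sum.mono_neutral_left ballI)
      fix B assume B: "B \<in> ?A - C \<inter> ?A"
      then have "B \<in> extensional (set L)" "B \<notin> C" by (auto simp: PiE_def)
      then obtain c where "c \<in> color ` set L" "proj B c \<noteq> b c" using C by blast
      then have "of_bool (charge y = Some c) + proj B c \<noteq> of_bool (charge x = Some c) + proj T c"
        using True by (metis add_left_cancel)
      then show "?P B = 0" using *[of B c] by blast
    qed (auto intro: finite_PiE)
    finally show ?thesis using True sum_bottoms[OF L(1)] vertex_weight_path_sum[OF L(2)] by simp
  next
    case False
    then obtain c where c: "c \<in> color ` set L"
      "of_bool (charge y = Some c) + b c \<noteq> of_bool (charge x = Some c) + proj T c" by blast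
    have "?P B = 0" if "B \<in> C" for B
    proof -
      have "proj B c = b c" using C that c(1) by blast
      with c(2) *[of B c] show ?thesis by argo
    qed
    then show ?thesis using False by (auto simp: vertex_weight_path_sum[OF L(2)])
  qed
qed

end

subsection \<open>Sums over states\<close>

text \<open>Positions are eliminated in order of decreasing rank. A position of largest rank is read
  by no other, so the sum over its value meets only its own factor and gives \<open>c p\<close>,
  whatever the values at its inputs.\<close>

lemma sum_prod_PiE_sequential:
  fixes rank :: "'p \<Rightarrow> nat" and w :: "'p \<Rightarrow> ('p \<Rightarrow> 'o) \<Rightarrow> 'o \<Rightarrow> 'b::comm_semiring_1"
  assumes "finite P"
    and dep: "\<And>p s s' y. p \<in> P \<Longrightarrow> (\<And>q. q \<in> inputs p \<Longrightarrow> s q = s' q) \<Longrightarrow> w p s y = w p s' y"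
    and inputs: "\<And>p q. p \<in> P \<Longrightarrow> q \<in> inputs p \<Longrightarrow> q \<in> P \<and> rank q < rank p"
    and sum: "\<And>p s. p \<in> P \<Longrightarrow> (\<And>q. q \<in> inputs p \<Longrightarrow> s q \<in> F q) \<Longrightarrow> (\<Sum>y\<in>F p. w p s y) = c p"
  shows "(\<Sum>s\<in>Pi\<^sub>E P F. \<Prod>p\<in>P. w p s (s p)) = (\<Prod>p\<in>P. c p)"
proof -
  \<comment> \<open>Generalised to subsets closed under inputs; they stay closed when an element of
    largest rank is removed.\<close>
  have "(\<Sum>s\<in>Pi\<^sub>E Q F. \<Prod>p\<in>Q. w p s (s p)) = (\<Prod>p\<in>Q. c p)"
    if "finite Q" "Q \<subseteq> P" "\<And>p q. p \<in> Q \<Longrightarrow> q \<in> inputs p \<Longrightarrow> q \<in> Q" for Q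
    using that
  proof (induction Q rule: finite_ranking_induct[where f = rank])
    case empty
    then show ?case by simp
  next
    case (insert p Q)
    show ?case
    proof (cases "p \<in> Q")
      case True
      with insert show ?thesis by (simp add: insert_absorb)
    next
      case False
      have closed: "q \<in> Q" if "p' \<in> insert p Q" "q \<in> inputs p'" for p' q
        using insert.hyps insert.prems inputs that by (metis insertE insert_subset less_irrefl linorder_not_le subsetD)
      \<comment> \<open>So no weight, \<open>w p\<close> included, reads the value at
        \<open>p\<close> through its state argument.\<close>
      have upd: "w p' (s(p := y)) = w p' s" if "p' \<in> insert p Q" for p' s y
        using dep[of p' "s(p := y)" s] closed[OF that] False insert.prems that by fastforce
      have "(\<Sum>s\<in>Pi\<^sub>E (insert p Q) F. \<Prod>p'\<in>insert p Q. w p' s (s p')) =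
          (\<Sum>(y, s)\<in>F p \<times> Pi\<^sub>E Q F. \<Prod>p'\<in>insert p Q. w p' (s(p := y)) ((s(p := y)) p'))"
        using inj_combinator[OF False, of F] by (auto simp: PiE_insert_eq sum.reindex intro!: sum.cong)
      also have "\<dots> = (\<Sum>(y, s)\<in>F p \<times> Pi\<^sub>E Q F. w p s y * (\<Prod>p'\<in>Q. w p' s (s p')))"
        using False insert.hyps by (auto simp: upd intro!: sum.cong prod.cong arg_cong2[where f = "(*)"])
      also have "\<dots> = (\<Sum>s\<in>Pi\<^sub>E Q F. \<Sum>y\<in>F p. w p s y * (\<Prod>p'\<in>Q. w p' s (s p')))"
        by (subst sum.swap) (simp add: sum.cartesian_product)
      also have "\<dots> = (\<Sum>s\<in>Pi\<^sub>E Q F. c p * (\<Prod>p'\<in>Q. w p' s (s p')))"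
      proof (intro sum.cong refl)
        fix s assume "s \<in> Pi\<^sub>E Q F"
        then have "(\<Sum>y\<in>F p. w p s y) = c p"
          using closed[of p] insert.prems by (intro sum) auto
        then show "(\<Sum>y\<in>F p. w p s y * (\<Prod>p'\<in>Q. w p' s (s p'))) = c p * (\<Prod>p'\<in>Q. w p' s (s p'))"
          by (simp flip: sum_distrib_right)
      qed
      also have "\<dots> = c p * (\<Prod>p'\<in>Q. c p')"
        unfolding sum_distrib_left[symmetric]
        by (subst insert.IH) (use insert.prems closed in blast)+
      finally show ?thesis using False insert.hyps by simp
    qed
  qed
  from this[OF assms(1)] inputs show ?thesis by blast
qed

text \<open>Assignments are grouped by their pointwise images. The fibre over \<open>s'\<close> is
  again a product set, as \<open>sum_prod_PiE_sequential\<close> requires.\<close>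

lemma sum_PiE_fibers:
  assumes "finite P" and F: "\<And>p. p \<in> P \<Longrightarrow> finite (F p)" and G: "\<And>p. p \<in> P \<Longrightarrow> finite (G p)"
    and \<phi>: "\<And>p y. p \<in> P \<Longrightarrow> y \<in> F p \<Longrightarrow> \<phi> y \<in> G p"
  shows "(\<Sum>s\<in>Pi\<^sub>E P F. W s) = (\<Sum>s'\<in>Pi\<^sub>E P G. \<Sum>s\<in>(\<Pi>\<^sub>E p\<in>P. {y \<in> F p. \<phi> y = s' p}). W s)"
proof -
  have fin: "finite (Pi\<^sub>E P F)" "finite (Pi\<^sub>E P G)"
    by (rule finite_PiE[OF \<open>finite P\<close>], erule F, rule finite_PiE[OF \<open>finite P\<close>], erule G)
  have img: "(\<lambda>s. \<lambda>p\<in>P. \<phi> (s p)) ` Pi\<^sub>E P F \<subseteq> Pi\<^sub>E P G"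
  proof (rule image_subsetI)
    fix s assume s: "s \<in> Pi\<^sub>E P F"
    have "\<phi> (s p) \<in> G p" if "p \<in> P" for p
      by (rule \<phi>[OF that PiE_mem[OF s that]])
    then show "(\<lambda>p\<in>P. \<phi> (s p)) \<in> Pi\<^sub>E P G" by (simp add: restrict_PiE_iff)
  qed
  have "(\<Sum>s\<in>Pi\<^sub>E P F. W s) =
      (\<Sum>s'\<in>Pi\<^sub>E P G. \<Sum>s | s \<in> Pi\<^sub>E P F \<and> (\<lambda>p\<in>P. \<phi> (s p)) = s'. W s)"
    by (rule sum.group[OF fin img, symmetric])
  also have "\<dots> = (\<Sum>s'\<in>Pi\<^sub>E P G. \<Sum>s\<in>(\<Pi>\<^sub>E p\<in>P. {y \<in> F p. \<phi> y = s' p}). W s)"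
  proof (intro sum.cong refl)
    fix s' assume s': "s' \<in> Pi\<^sub>E P G"
    have "(\<lambda>p\<in>P. \<phi> (s p)) = s' \<longleftrightarrow> (\<forall>p\<in>P. \<phi> (s p) = s' p)" for s
      using s' by (auto simp: fun_eq_iff PiE_def extensional_def)
    then show "{s. s \<in> Pi\<^sub>E P F \<and> (\<lambda>p\<in>P. \<phi> (s p)) = s'} = (\<Pi>\<^sub>E p\<in>P. {y \<in> F p. \<phi> y = s' p})"
      by (auto simp: PiE_iff extensional_def)
  qed
  finally show ?thesis .
qed

text \<open>A state is encoded by the function \<open>s\<close> that maps a vertex to the spin on its left edge and
  the configuration on its bottom edge; its other two edges belong to its right and upper
  neighbours or to the boundary.\<close>

definition right_edge :: "(nat \<Rightarrow> 'h) \<Rightarrow> (nat \<times> nat \<Rightarrow> 'h \<times> 'v) \<Rightarrow> nat \<times> nat \<Rightarrow> 'h" where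
  "right_edge R s = (\<lambda>(i, j). if j = 0 then R i else fst (s (i, j - 1)))"

definition top_edge :: "(nat \<Rightarrow> 'v) \<Rightarrow> (nat \<times> nat \<Rightarrow> 'h \<times> 'v) \<Rightarrow> nat \<times> nat \<Rightarrow> 'v" where
  "top_edge T s = (\<lambda>(i, j). if i = 1 then T j else snd (s (i - 1, j)))"

definition grid_weight ::
  "('a::field, 'l, 'h) unfused \<Rightarrow> 'l list \<Rightarrow> 'h set \<Rightarrow> nat \<Rightarrow> nat \<Rightarrow> (nat \<Rightarrow> 'a) \<Rightarrow>
   (nat \<Rightarrow> 'h) \<Rightarrow> (nat \<Rightarrow> 'l \<Rightarrow> nat) \<Rightarrow> (nat \<times> nat \<Rightarrow> 'h \<times> ('l \<Rightarrow> nat)) \<Rightarrow> 'a"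
where
  "grid_weight U L H r N z R T s = (\<Prod>p\<in>{1..r} \<times> {..<N}.
     vertex_weight U L H (z (fst p)) (fst (s p)) (right_edge R s p) (top_edge T s p) (snd (s p)))"

text \<open>\<open>X\<close> and \<open>v0\<close> impose the left and lower boundaries, and
  \<open>V\<close> cuts the vertical configurations down to a finite set. \<open>X i\<close> is a
  singleton for a single system and consists of all dolors once the left boundary is summed over.
  The right and upper boundaries enter through \<open>right_edge\<close> and
  \<open>top_edge\<close>.\<close>

definition outputs :: "nat \<Rightarrow> nat \<Rightarrow> 'h set \<Rightarrow> (nat \<Rightarrow> 'h set) \<Rightarrow> 'v set \<Rightarrow> 'v \<Rightarrow> nat \<times> nat \<Rightarrow> ('h \<times> 'v) set" where
  "outputs r N H X V v0 = (\<lambda>(i, j). (if Suc j = N then X i else H) \<times> (if i = r then {v0} else V))"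

lemma finite_outputs:
  assumes "finite H" "\<And>i. i \<in> {1..r} \<Longrightarrow> finite (X i)" "finite V" "p \<in> {1..r} \<times> {..<N}"
  shows "finite (outputs r N H X V v0 p)"
  using assms by (auto simp: outputs_def split: prod.split)

text \<open>The edge \<open>v (i, j)\<close> lies above the vertex in row \<open>Suc i\<close>,
  hence the shift. At the ends, \<open>top_edge\<close> in row \<open>Suc r\<close> reads the bottom
  boundary and \<open>right_edge\<close> in column \<open>N\<close> the left one.\<close>

definition state_of :: "nat \<Rightarrow> nat \<Rightarrow> (nat \<Rightarrow> 'h) \<Rightarrow> (nat \<Rightarrow> 'v) \<Rightarrow> (nat \<times> nat \<Rightarrow> 'h \<times> 'v) \<Rightarrow>
  (nat \<times> nat \<Rightarrow> 'h) \<times> (nat \<times> nat \<Rightarrow> 'v)"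
where
  "state_of r N R T s =
    (\<lambda>p\<in>{1..r} \<times> {0..N}. right_edge R s p,
     \<lambda>p\<in>{0..r} \<times> {..<N}. top_edge T s (Suc (fst p), snd p))"

definition outputs_of :: "nat \<Rightarrow> nat \<Rightarrow> (nat \<times> nat \<Rightarrow> 'h) \<times> (nat \<times> nat \<Rightarrow> 'v) \<Rightarrow> nat \<times> nat \<Rightarrow> 'h \<times> 'v" where
  "outputs_of r N = (\<lambda>(h, v). \<lambda>(i, j)\<in>{1..r} \<times> {..<N}. (h (i, Suc j), v (i, j)))"

section \<open>From states to functions on the vertices\<close>

context charged_weights begin

lemma fused_admissible_bottom_le:
  assumes "fused_admissible U L H z x y T B" "l \<in> set L"
  shows "B l \<le> Suc (T l)"
  using assms bottom_le unfolding fused_admissible_def fused_labelling_def in_set_conv_nth by metis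

text \<open>States correspond bijectively to the functions of the product set all of whose vertices
  are admissible; the other functions have weight 0. \<open>V\<close> may be any finite set
  containing the configurations bounded by \<open>M\<close>, so that the bicolored set can be chosen
  as the preimage of the colored one.\<close>

lemma partition_function_eq:
  fixes L :: "'l list"
  assumes "r \<ge> 1" "N \<ge> 1"
    and R: "\<And>i. i \<in> {1..r} \<Longrightarrow> right i \<in> H" and left: "\<And>i. i \<in> {1..r} \<Longrightarrow> left i \<in> H"
    and V: "finite V" "V \<subseteq> extensional (set L)"
      "\<And>B. B \<in> extensional (set L) \<Longrightarrow> (\<And>l. l \<in> set L \<Longrightarrow> B l \<le> M) \<Longrightarrow> B \<in> V"
    and M: "\<And>j l. j < N \<Longrightarrow> l \<in> set L \<Longrightarrow> T j l + r \<le> M"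
  shows "partition_function U L H r N z left right T =
    (\<Sum>s\<in>(\<Pi>\<^sub>E p\<in>{1..r} \<times> {..<N}. outputs r N H (\<lambda>i. {left i}) V (\<lambda>l\<in>set L. 0) p).
       grid_weight U L H r N z right (\<lambda>j. restrict (T j) (set L)) s)"
proof -
  let ?P = "{1..r} \<times> {..<N}" and ?F = "outputs r N H (\<lambda>i. {left i}) V (\<lambda>l\<in>set L. 0)"
  let ?T = "\<lambda>j. restrict (T j) (set L)"
  let ?w = "\<lambda>s p. vertex_weight U L H (z (fst p)) (fst (s p)) (right_edge right s p) (top_edge ?T s p) (snd (s p))"
  define adm where "adm = (\<lambda>s p. fused_admissible U L H (z (fst p)) (fst (s p)) (right_edge right s p)
    (top_edge ?T s p) (snd (s p)))"
  let ?S = "{s \<in> Pi\<^sub>E ?P ?F. \<forall>p\<in>?P. adm s p}"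
  let ?st = "states U L H r N z left right T"
  \<comment> \<open>A row raises a multiplicity by at most one, so the restriction to
    \<open>V\<close> loses no state.\<close>
  have v_le: "v (i, j) l \<le> T j l + i" if hv: "(h, v) \<in> ?st" and "i \<le> r" "j < N" "l \<in> set L" for h v i j l
    using that(2-)
  proof (induction i)
    case 0
    then show ?case using hv by (auto simp: states_def)
  next
    case (Suc i)
    then have "Suc i \<in> {1..r}" by simp
    then have "fused_admissible U L H (z (Suc i)) (h (Suc i, Suc j)) (h (Suc i, j)) (v (i, j)) (v (Suc i, j))"
      using hv Suc.prems unfolding states_def by fastforce
    from fused_admissible_bottom_le[OF this Suc.prems(3)] Suc show ?case by simp
  qed
  have out_st: "outputs_of r N a \<in> ?S" "state_of r N right ?T (outputs_of r N a) = a"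
    "(\<Prod>p\<in>?P. ?w (outputs_of r N a) p) = (case a of (h, v) \<Rightarrow>
        \<Prod>i\<in>{1..r}. \<Prod>j<N. fused_weight U L H (z i) (h (i, Suc j)) (h (i, j)) (v (i - 1, j)) (v (i, j)))"
    if "a \<in> ?st" for a
  proof -
    obtain h v where a: "a = (h, v)" by (cases a)
    let ?s = "outputs_of r N a"
    have hv: "h \<in> {1..r} \<times> {0..N} \<rightarrow>\<^sub>E H" "v \<in> {0..r} \<times> {..<N} \<rightarrow>\<^sub>E (set L \<rightarrow>\<^sub>E UNIV)"
      "\<And>i. i \<in> {1..r} \<Longrightarrow> h (i, N) = left i" "\<And>i. i \<in> {1..r} \<Longrightarrow> h (i, 0) = right i"
      "\<And>j l. j < N \<Longrightarrow> l \<in> set L \<Longrightarrow> v (0, j) l = T j l" "\<And>j l. j < N \<Longrightarrow> l \<in> set L \<Longrightarrow> v (r, j) l = 0"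
      "\<And>i j. i \<in> {1..r} \<Longrightarrow> j < N \<Longrightarrow>
           fused_admissible U L H (z i) (h (i, Suc j)) (h (i, j)) (v (i - 1, j)) (v (i, j))"
      using that unfolding a states_def by auto
    have ext: "v (i, j) \<in> extensional (set L)" if "i \<le> r" "j < N" for i j
      using PiE_mem[OF hv(2), of "(i, j)"] that by (auto simp: PiE_def)
    have v0: "v (0, j) = ?T j" if "j < N" for j
      using ext[of 0 j] hv(5) that by (intro extensionalityI[of _ "set L"]) auto
    have vr: "v (r, j) = (\<lambda>l\<in>set L. 0)" if "j < N" for j
      using ext[of r j] hv(6) that by (intro extensionalityI[of _ "set L"]) auto
    have right: "right_edge right ?s (i, j) = h (i, j)" if "i \<in> {1..r}" "j \<le> N" for i j
      using that hv(4) by (auto simp: right_edge_def outputs_of_def a)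
    have top: "top_edge ?T ?s (i, j) = v (i - 1, j)" if "i \<in> {1..Suc r}" "j < N" for i j
      using that v0 by (auto simp: top_edge_def outputs_of_def a)
    have s: "?s (i, j) = (h (i, Suc j), v (i, j))" if "i \<in> {1..r}" "j < N" for i j
      using that by (auto simp: outputs_of_def a)
    have adm: "adm ?s p" if "p \<in> ?P" for p
      using that hv(7) by (auto simp: adm_def s right top)
    moreover have "?s p \<in> ?F p" if "p \<in> ?P" for p
    proof -
      obtain i j where p: "p = (i, j)" "i \<in> {1..r}" "j < N" using \<open>p \<in> ?P\<close> by auto
      have "v (i, j) l \<le> M" if "l \<in> set L" for l
        using v_le[of h v i j l] \<open>a \<in> ?st\<close> M[of j l] p that by (auto simp: a)
      then have "v (i, j) \<in> V" using ext p by (intro V(3)) auto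
      moreover have "h (i, Suc j) \<in> H" using p by (intro PiE_mem[OF hv(1)]) auto
      ultimately show ?thesis using p hv(3) vr by (auto simp: outputs_def s)
    qed
    ultimately show "?s \<in> ?S" by (auto simp: outputs_of_def a)
    have "(\<lambda>p\<in>{1..r} \<times> {0..N}. right_edge right ?s p) = h"
      using hv(1) right by (intro extensionalityI[of _ "{1..r} \<times> {0..N}"]) (auto simp: PiE_def)
    moreover have "(\<lambda>p\<in>{0..r} \<times> {..<N}. top_edge ?T ?s (Suc (fst p), snd p)) = v"
      using hv(2) top by (intro extensionalityI[of _ "{0..r} \<times> {..<N}"]) (auto simp: PiE_def)
    ultimately show "state_of r N right ?T ?s = a" by (simp add: state_of_def a)
    have "?w ?s p = (case p of (i, j) \<Rightarrow>
        fused_weight U L H (z i) (h (i, Suc j)) (h (i, j)) (v (i - 1, j)) (v (i, j)))" if "p \<in> ?P" for p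
      using that adm[OF that] by (auto simp: vertex_weight_def adm_def s right top)
    then show "(\<Prod>p\<in>?P. ?w ?s p) = (case a of (h, v) \<Rightarrow>
        \<Prod>i\<in>{1..r}. \<Prod>j<N. fused_weight U L H (z i) (h (i, Suc j)) (h (i, j)) (v (i - 1, j)) (v (i, j)))"
      by (simp add: a prod.cartesian_product)
  qed
  have st_out: "state_of r N right ?T s \<in> ?st" "outputs_of r N (state_of r N right ?T s) = s"
    if "s \<in> ?S" for s
  proof -
    have s: "s (i, j) \<in> ?F (i, j)" "adm s (i, j)" if "i \<in> {1..r}" "j < N" for i j
      using \<open>s \<in> ?S\<close> that by (auto simp: PiE_iff)
    have "fst (s (i, j)) \<in> H" if "i \<in> {1..r}" "j < N" for i j
      using s(1)[OF that] left that by (auto simp: outputs_def split: if_splits)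
    then have 1: "right_edge right s (i, j) \<in> H" if "i \<in> {1..r}" "j \<le> N" for i j
      using that R by (auto simp: right_edge_def)
    have "snd (s (i, j)) \<in> extensional (set L)" if "i \<in> {1..r}" "j < N" for i j
      using s(1)[OF that] V(2) by (auto simp: outputs_def split: if_splits)
    then have 2: "top_edge ?T s (Suc i, j) \<in> extensional (set L)" if "i \<le> r" "j < N" for i j
      using that by (auto simp: top_edge_def)
    have 3: "top_edge ?T s (Suc r, j) = (\<lambda>l\<in>set L. 0)" if "j < N" for j
      using s(1)[of r j] that \<open>r \<ge> 1\<close> by (auto simp: top_edge_def outputs_def)
    have 4: "right_edge right s (i, N) = left i" if "i \<in> {1..r}" for i
      using s(1)[of i "N - 1"] that \<open>N \<ge> 1\<close> by (auto simp: right_edge_def outputs_def)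
    have 5: "fused_admissible U L H (z i) (right_edge right s (i, Suc j)) (right_edge right s (i, j))
        (top_edge ?T s (Suc (i - 1), j)) (top_edge ?T s (Suc i, j))" if "i \<in> {1..r}" "j < N" for i j
      using s(2)[OF that] that by (auto simp: adm_def right_edge_def top_edge_def)
    define h where "h = (\<lambda>p\<in>{1..r} \<times> {0..N}. right_edge right s p)"
    define v where "v = (\<lambda>p\<in>{0..r} \<times> {..<N}. top_edge ?T s (Suc (fst p), snd p))"
    have h: "h (i, j) = right_edge right s (i, j)" if "i \<in> {1..r}" "j \<le> N" for i j
      using that by (simp add: h_def)
    have v: "v (i, j) = top_edge ?T s (Suc i, j)" if "i \<le> r" "j < N" for i j
      using that by (simp add: v_def)
    have "(h, v) \<in> ?st"
      unfolding states_def mem_Collect_eq prod.case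
    proof (intro conjI ballI allI impI)
      show "h \<in> {1..r} \<times> {0..N} \<rightarrow>\<^sub>E H" using 1 by (auto simp: h_def)
      show "v \<in> {0..r} \<times> {..<N} \<rightarrow>\<^sub>E (set L \<rightarrow>\<^sub>E UNIV)" using 2 by (auto simp: v_def PiE_def)
    next
      fix i assume i: "i \<in> {1..r}"
      show "h (i, N) = left i" using h 4 i by simp
      show "h (i, 0) = right i" using h i by (simp add: right_edge_def)
      fix j assume j: "j < N"
      have "i - 1 \<le> r" "i \<le> r" using i by auto
      then show "fused_admissible U L H (z i) (h (i, Suc j)) (h (i, j)) (v (i - 1, j)) (v (i, j))"
        using 5[OF i j] h[OF i] v[OF _ j] j by simp
    next
      fix j l assume j: "j < N" "l \<in> set L"
      show "v (0, j) l = T j l" using v j by (simp add: top_edge_def)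
      show "v (r, j) l = 0" using v 3 j by simp
    qed
    then show "state_of r N right ?T s \<in> ?st" by (simp add: state_of_def h_def v_def)
    have "s \<in> extensional ?P" using \<open>s \<in> ?S\<close> by (auto simp: PiE_def)
    then show "outputs_of r N (state_of r N right ?T s) = s"
      by (intro extensionalityI[of _ ?P]) (auto simp: outputs_of_def state_of_def right_edge_def top_edge_def)
  qed
  have "partition_function U L H r N z left right T = (\<Sum>s\<in>?S. \<Prod>p\<in>?P. ?w s p)"
    unfolding partition_function_def
    by (rule sum.reindex_bij_witness[where i = "state_of r N right ?T" and j = "outputs_of r N"])
      (use out_st st_out in auto)
  also have "\<dots> = (\<Sum>s\<in>Pi\<^sub>E ?P ?F. \<Prod>p\<in>?P. ?w s p)"
  proof (intro sum.mono_neutral_left ballI)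
    show "finite (Pi\<^sub>E ?P ?F)"
      using finite_spins V(1) by (intro finite_PiE finite_outputs) auto
    fix s assume "s \<in> Pi\<^sub>E ?P ?F - ?S"
    then obtain p where "p \<in> ?P" "\<not> adm s p" by auto
    then show "(\<Prod>p\<in>?P. ?w s p) = 0"
      by (intro prod_zero bexI[of _ p]) (auto simp: vertex_weight_def adm_def)
  qed auto
  finally show ?thesis by (simp only: grid_weight_def)
qed

end

subsection \<open>Path sums of the two models\<close>

abbreviation bi_spins :: "nat \<Rightarrow> bi_spin set" where
  "bi_spins r \<equiv> Color ` {1..r} \<union> Dolor ` {1..r}"

abbreviation col_spins :: "nat \<Rightarrow> col_spin set" where
  "col_spins r \<equiv> Particle ` {1..r} \<union> {Plus}"

fun bi_charge :: "bi_spin \<Rightarrow> nat option" where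
  "bi_charge (Color a) = Some a"
| "bi_charge (Dolor d) = None"

fun col_charge :: "col_spin \<Rightarrow> nat option" where
  "col_charge (Particle a) = Some a"
| "col_charge Plus = None"

fun merge :: "bi_spin \<Rightarrow> col_spin" where
  "merge (Color a) = Particle a"
| "merge (Dolor d) = Plus"

lemma bi_charged_weights: "charged_weights (bi_unfused t) (bi_spins r) fst bi_charge"
proof
  fix z l x y y' m n assume "bi_unfused t z l x y m n \<noteq> None" "bi_unfused t z l x y' m n \<noteq> None"
  then show "y = y'"
    by (cases l; cases x; cases y; cases y') (auto split: if_splits)
next
  fix z l x y m n c assume "bi_unfused t z l x y m n \<noteq> None"
  then show "of_bool (bi_charge y = Some c) + of_bool (fst l = c) * int n =
      of_bool (bi_charge x = Some c) + of_bool (fst l = c) * int m"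
    by (cases l; cases x; cases y) (auto split: if_splits)
qed simp

lemma col_charged_weights: "charged_weights (col_unfused t) (col_spins r) (\<lambda>c. c) col_charge"
proof
  fix z l x y y' m n assume "col_unfused t z l x y m n \<noteq> None" "col_unfused t z l x y' m n \<noteq> None"
  then show "y = y'"
    by (cases x; cases y; cases y') (auto split: if_splits)
next
  fix z l x y m n c assume "col_unfused t z l x y m n \<noteq> None"
  then show "of_bool (col_charge y = Some c) + of_bool (l = c) * int n =
      of_bool (col_charge x = Some c) + of_bool (l = c) * int m"
    by (cases x; cases y) (auto split: if_splits)
qed simp

section \<open>Unfused weights summed over the bottom multiplicity\<close>

lemma bottomless_bi [simp]:
  "bottomless_weight (bi_unfused t) z (c, d) (Dolor x) (Dolor y) m =
     (if x = y then if x = d then 1 else z ^ (if c = 1 then 1 else 0) * t ^ (if x < d then m else 0) else 0)"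
  "bottomless_weight (bi_unfused t) z (c, d) (Color a) (Color b) m =
     (if a = b then if a = c then z else if c > a then t ^ m else 1 else 0)"
  "bottomless_weight (bi_unfused t) z (c, d) (Dolor x) (Color a) m =
     (if x = d \<and> a = c then \<Sum>k<m. t ^ k else 0)"
  "bottomless_weight (bi_unfused t) z (c, d) (Color a) (Dolor x) m =
     (if a = c \<and> x = d then (1 - t) * z else 0)"
proof -
  \<comment> \<open>The condition \<open>m \<ge> 1\<close> disappears because for
    \<open>m = 0\<close> the geometric sum is empty.\<close>
  show "bottomless_weight (bi_unfused t) z (c, d) (Dolor x) (Color a) m =
     (if x = d \<and> a = c then \<Sum>k<m. t ^ k else 0)"
    by (subst bottomless_weight_eq[where P = "x = d \<and> a = c \<and> m \<ge> 1" and k = "m - 1"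
      and w = "\<Sum>k<m. t ^ k"]) (auto simp: not_le)
  show "bottomless_weight (bi_unfused t) z (c, d) (Dolor x) (Dolor y) m =
     (if x = y then if x = d then 1 else z ^ (if c = 1 then 1 else 0) * t ^ (if x < d then m else 0) else 0)"
    by (subst bottomless_weight_eq[where P = "x = y" and k = m
      and w = "if x = d then 1 else z ^ (if c = 1 then 1 else 0) * t ^ (if x < d then m else 0)"]) auto
  show "bottomless_weight (bi_unfused t) z (c, d) (Color a) (Color b) m =
     (if a = b then if a = c then z else if c > a then t ^ m else 1 else 0)"
    by (subst bottomless_weight_eq[where P = "a = b" and k = m
      and w = "if a = c then z else if c > a then t ^ m else 1"]) auto
  show "bottomless_weight (bi_unfused t) z (c, d) (Color a) (Dolor x) m =
     (if a = c \<and> x = d then (1 - t) * z else 0)"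
    by (subst bottomless_weight_eq[where P = "a = c \<and> x = d" and k = "m + 1" and w = "(1 - t) * z"]) auto
qed

lemma bottomless_col [simp]:
  "bottomless_weight (col_unfused t) z c Plus Plus m = 1"
  "bottomless_weight (col_unfused t) z c (Particle a) (Particle b) m =
     (if a = b then if a = c then z else if c > a then t ^ m else 1 else 0)"
  "bottomless_weight (col_unfused t) z c Plus (Particle a) m = (if a = c then \<Sum>k<m. t ^ k else 0)"
  "bottomless_weight (col_unfused t) z c (Particle a) Plus m = (if a = c then (1 - t) * z else 0)"
proof -
  show "bottomless_weight (col_unfused t) z c Plus (Particle a) m = (if a = c then \<Sum>k<m. t ^ k else 0)"
    by (subst bottomless_weight_eq[where P = "a = c \<and> m \<ge> 1" and k = "m - 1"
      and w = "\<Sum>k<m. t ^ k"]) (auto simp: not_le)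
  show "bottomless_weight (col_unfused t) z c Plus Plus m = 1"
    by (subst bottomless_weight_eq[where P = True and k = m and w = 1]) auto
  show "bottomless_weight (col_unfused t) z c (Particle a) (Particle b) m =
     (if a = b then if a = c then z else if c > a then t ^ m else 1 else 0)"
    by (subst bottomless_weight_eq[where P = "a = b" and k = m
      and w = "if a = c then z else if c > a then t ^ m else 1"]) auto
  show "bottomless_weight (col_unfused t) z c (Particle a) Plus m = (if a = c then (1 - t) * z else 0)"
    by (subst bottomless_weight_eq[where P = "a = c" and k = "m + 1" and w = "(1 - t) * z"]) auto
qed

lemma sum_bi_spins:
  "(\<Sum>g\<in>bi_spins r. f g) = (\<Sum>a=1..r. f (Color a)) + (\<Sum>d=1..r. f (Dolor d))"
proof -
  have "(\<Sum>g\<in>bi_spins r. f g) = sum f (Color ` {1..r}) + sum f (Dolor ` {1..r})"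
    by (intro sum.union_disjoint) auto
  then show ?thesis by (simp add: sum.reindex inj_on_def)
qed

lemma sum_col_spins:
  "(\<Sum>g\<in>col_spins r. f g) = (\<Sum>a=1..r. f (Particle a)) + f Plus"
proof -
  have "(\<Sum>g\<in>col_spins r. f g) = sum f (Particle ` {1..r}) + sum f {Plus}"
    by (intro sum.union_disjoint) auto
  then show ?thesis by (simp add: sum.reindex inj_on_def)
qed

lemma sum_single:
  assumes "finite A" "a \<in> A" "\<And>x. x \<in> A \<Longrightarrow> x \<noteq> a \<Longrightarrow> f x = 0"
  shows "sum f A = f a"
  using assms by (subst sum.remove[of A a]) (auto intro: sum.neutral)

lemma geometric_add: "(\<Sum>k<m + n. t ^ k) = (\<Sum>k<m. t ^ k) + t ^ m * (\<Sum>k<n. (t::'a::comm_ring_1) ^ k)"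
  by (induction n) (auto simp: algebra_simps power_add)

lemma geometric_mult: "(1 - t) * (\<Sum>k<m. (t::'a::comm_ring_1) ^ k) = 1 - t ^ m"
  by (simp add: one_diff_power_eq)

text \<open>The weight of a fused colored vertex, as a function of the number \<open>p\<close> of particles of color \<open>b\<close>
  and the number \<open>s\<close> of particles of larger color on the top edge.\<close>

fun transfer :: "'a::field \<Rightarrow> 'a \<Rightarrow> col_spin \<Rightarrow> col_spin \<Rightarrow> nat \<Rightarrow> nat \<Rightarrow> 'a" where
  "transfer t z Plus Plus p s = 1"
| "transfer t z Plus (Particle b) p s = (\<Sum>k<p. t ^ k) * t ^ s"
| "transfer t z (Particle a) Plus p s = (1 - t) * z"
| "transfer t z (Particle a) (Particle b) p s =
     (if a = b then z * t ^ s else if a < b then (1 - t) * z * (\<Sum>k<p. t ^ k) * t ^ s else 0)"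

text \<open>The path sum from \<open>X\<close> to \<open>+\<close> over the colored vertices with labels \<open>1, \<dots>, c\<close>.\<close>

fun released :: "'a::field \<Rightarrow> 'a \<Rightarrow> col_spin \<Rightarrow> nat \<Rightarrow> 'a" where
  "released t z Plus c = 1"
| "released t z (Particle a) c = (if a \<le> c then (1 - t) * z else 0)"

text \<open>A path that ends in color \<open>b\<close> carries \<open>b\<close> past every larger
  label, at a factor \<open>t\<close> per particle met there.\<close>

lemma transfer_add_above: "transfer t z X (Particle b) p (s + m) = transfer t z X (Particle b) p s * t ^ m"
  by (cases X) (auto simp: power_add)

text \<open>In the geometric sum of length \<open>p + m\<close> the last \<open>m\<close> terms
  share the factor \<open>t ^ p\<close>. This is the change in the entry of a color when
  \<open>m\<close> more bosons of this color are read with a further dolor.\<close>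

lemma transfer_add_same:
  "transfer t z X (Particle (Suc c)) (p + m) s =
     transfer t z X (Particle (Suc c)) p s + (\<Sum>k<m. t ^ k) * (t ^ (p + s) * released t z X c)"
proof -
  have "(\<Sum>k<p + m. t ^ k) * t ^ s = (\<Sum>k<p. t ^ k) * t ^ s + (\<Sum>k<m. t ^ k) * t ^ (p + s)"
    unfolding geometric_add power_add by (simp add: algebra_simps)
  then show ?thesis by (cases X) (auto simp: mult.assoc distrib_left)
qed

text \<open>By \<open>geometric_mult\<close> the second term contributes \<open>1 - t ^ p\<close>,
  which complements the \<open>t ^ p\<close> of the first. This updates the entry of the dolor whose
  block is being read.\<close>

lemma released_Suc:
  "t ^ (p + s) * released t z X c + (1 - t) * transfer t z X (Particle (Suc c)) p s =
     t ^ s * released t z X (Suc c)"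
proof -
  have "(1 - t) * ((\<Sum>k<p. t ^ k) * t ^ s) = (1 - t ^ p) * t ^ s"
    by (simp only: geometric_mult mult.assoc[symmetric])
  then have *: "t ^ (p + s) + (1 - t) * ((\<Sum>k<p. t ^ k) * t ^ s) = t ^ s"
    by (simp add: power_add algebra_simps)
  have "t ^ (p + s) * y + (1 - t) * (y * (\<Sum>k<p. t ^ k) * t ^ s) = t ^ s * y" for y
  proof -
    have "t ^ (p + s) * y + (1 - t) * (y * (\<Sum>k<p. t ^ k) * t ^ s) =
        (t ^ (p + s) + (1 - t) * ((\<Sum>k<p. t ^ k) * t ^ s)) * y"
      by (simp add: algebra_simps)
    then show ?thesis by (simp only: *)
  qed
  from this[of "(1 - t) * z"] * show ?thesis by (cases X) (auto simp: not_le)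
qed

lemma released_transfer:
  assumes "X \<in> col_spins r"
  shows "released t z X r = transfer t z X Plus p s"
  using assms by auto

text \<open>A color beyond \<open>c\<close> can only come from the left edge, since its label has
  not been read. A color up to \<open>c\<close> has its final value except for the larger colors
  still to come, which \<open>transfer_add_above\<close> supplies.\<close>

lemma path_sum_col_prefix:
  fixes T :: "nat \<Rightarrow> nat"
  defines "v \<equiv> \<lambda>t z r X c. path_sum (\<lambda>l x y. bottomless_weight (col_unfused t) z l x y (T l)) (col_spins r) [1..<Suc c] X"
  assumes X: "X \<in> col_spins r" and "c \<le> r"
  shows "(\<forall>b\<in>{1..r}. v t z r X c (Particle b) =
      (if b \<le> c then transfer t z X (Particle b) (T b) (\<Sum>a\<in>{b<..c}. T a) else of_bool (X = Particle b))) \<and>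
    v t z r X c Plus = released t z X c"
  using assms(3)
proof (induction c)
  case 0
  then show ?case using X by (auto simp: v_def)
next
  case (Suc c)
  let ?w = "\<lambda>x y. bottomless_weight (col_unfused t) z (Suc c) x y (T (Suc c))"
  let ?v = "v t z r X c" and ?v' = "v t z r X (Suc c)"
  have snoc: "?v' y = (\<Sum>a=1..r. ?v (Particle a) * ?w (Particle a) y) + ?v Plus * ?w Plus y"
    if "y \<in> col_spins r" for y
  proof -
    have "[1..<Suc (Suc c)] = [1..<Suc c] @ [Suc c]" by simp
    then have "?v' y = (\<Sum>g\<in>col_spins r. ?v g * ?w g y)"
      unfolding v_def by (simp only:) (rule path_sum_snoc, use that X in auto)
    then show ?thesis by (simp only: sum_col_spins)
  qed
  have IH: "?v (Particle b) = (if b \<le> c then transfer t z X (Particle b) (T b) (\<Sum>a\<in>{b<..c}. T a)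
       else of_bool (X = Particle b))" if "b \<in> {1..r}" for b
    using Suc that by simp
  have IH_Plus: "?v Plus = released t z X c" using Suc by simp
  have c: "Suc c \<in> {1..r}" using Suc by simp
  have "?v' (Particle b) = (if b \<le> Suc c then transfer t z X (Particle b) (T b) (\<Sum>a\<in>{b<..Suc c}. T a)
       else of_bool (X = Particle b))" if b: "b \<in> {1..r}" for b
  proof -
    have "(\<Sum>a=1..r. ?v (Particle a) * ?w (Particle a) (Particle b)) = ?v (Particle b) * ?w (Particle b) (Particle b)"
      using b by (intro sum_single) auto
    then have v': "?v' (Particle b) = ?v (Particle b) * ?w (Particle b) (Particle b) + ?v Plus * ?w Plus (Particle b)"
      using snoc[of "Particle b"] b by simp
    consider "b \<le> c" | "b = Suc c" | "b > Suc c" by linarith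
    then show ?thesis
    proof cases
      case 1
      then have "{b<..Suc c} = insert (Suc c) {b<..c}" by auto
      then have "(\<Sum>a\<in>{b<..Suc c}. T a) = (\<Sum>a\<in>{b<..c}. T a) + T (Suc c)" by simp
      then show ?thesis using 1 v' IH[OF b] by (simp add: transfer_add_above)
    next
      case 2
      \<comment> \<open>At its own label a color either continues from the left edge with weight
        \<open>z\<close> or is taken out of the column by an incoming \<open>+\<close>.\<close>
      have "transfer t z X (Particle (Suc c)) (T (Suc c)) 0 =
          of_bool (X = Particle (Suc c)) * z + released t z X c * (\<Sum>k<T (Suc c). t ^ k)"
        by (cases X) auto
      then show ?thesis using 2 v' IH[OF b] IH_Plus by simp
    next
      case 3
      then show ?thesis using v' IH[OF b] by simp
    qed
  qed
  moreover have "?v' Plus = released t z X (Suc c)"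
  proof -
    have "(\<Sum>a=1..r. ?v (Particle a) * ?w (Particle a) Plus) = ?v (Particle (Suc c)) * ?w (Particle (Suc c)) Plus"
      using c by (intro sum_single) auto
    then have "?v' Plus = of_bool (X = Particle (Suc c)) * ((1 - t) * z) + released t z X c"
      using snoc[of Plus] IH[OF c] IH_Plus by simp
    then show ?thesis by (cases X) auto
  qed
  ultimately show ?case by blast
qed

lemma path_sum_col:
  fixes T :: "nat \<Rightarrow> nat"
  assumes "X \<in> col_spins r" "Y \<in> col_spins r"
  shows "path_sum (\<lambda>l x y. bottomless_weight (col_unfused t) z l x y (T l)) (col_spins r) [1..<Suc r] X Y =
    (case Y of Plus \<Rightarrow> transfer t z X Plus 0 0 | Particle b \<Rightarrow> transfer t z X (Particle b) (T b) (\<Sum>a\<in>{b<..r}. T a))"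
  using path_sum_col_prefix[OF assms(1), of r t z T] assms(2) released_transfer[OF assms(1)]
  by (auto simp del: upt_Suc)

section \<open>Path sums of the bicolored vertex, block by block\<close>

definition block :: "nat \<Rightarrow> nat \<Rightarrow> (nat \<times> nat) list" where
  "block d c = map (\<lambda>a. (a, d)) [1..<Suc c]"

lemma block_0 [simp]: "block d 0 = []"
  by (simp add: block_def)

lemma block_Suc [simp]: "block d (Suc c) = block d c @ [(Suc c, d)]"
  by (simp add: block_def)

lemma bi_labels_block: "bi_labels r = concat (map (\<lambda>d. block d r) (rev [1..<Suc r]))"
  by (simp add: bi_labels_def block_def)

context
  fixes t z :: "'a::field" and r :: nat and X :: col_spin and T :: "nat \<times> nat \<Rightarrow> nat"
  assumes X: "X \<in> col_spins r" and z: "z \<noteq> 0"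
begin

text \<open>A row vector: the left spins with image \<open>X\<close> are summed at the start, so
  that one vector is propagated instead of a matrix.\<close>

definition bi_vector :: "(nat \<times> nat) list \<Rightarrow> bi_spin \<Rightarrow> 'a" where
  "bi_vector ls y = (\<Sum>x | x \<in> bi_spins r \<and> merge x = X.
     path_sum (\<lambda>l x y. bottomless_weight (bi_unfused t) z l x y (T l)) (bi_spins r) ls x y)"

lemma bi_vector_Nil:
  assumes "y \<in> bi_spins r"
  shows "bi_vector [] y = of_bool (merge y = X)"
proof -
  let ?S = "{x \<in> bi_spins r. merge x = X}"
  have "bi_vector [] y = (\<Sum>x\<in>?S. if x = y then 1 else 0)"
    by (simp add: bi_vector_def of_bool_def)
  also have "\<dots> = (if y \<in> ?S then 1 else 0)"
    by (rule sum.delta) simp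
  finally show ?thesis using assms by simp
qed

lemma bi_vector_snoc:
  assumes "y \<in> bi_spins r"
  shows "bi_vector (ls @ [l]) y =
    (\<Sum>a=1..r. bi_vector ls (Color a) * bottomless_weight (bi_unfused t) z l (Color a) y (T l)) +
    (\<Sum>d=1..r. bi_vector ls (Dolor d) * bottomless_weight (bi_unfused t) z l (Dolor d) y (T l))"
proof -
  let ?w = "\<lambda>l x y. bottomless_weight (bi_unfused t) z l x y (T l)"
  let ?S = "{x \<in> bi_spins r. merge x = X}"
  have "bi_vector (ls @ [l]) y = (\<Sum>x\<in>?S. \<Sum>g\<in>bi_spins r. path_sum ?w (bi_spins r) ls x g * ?w l g y)"
    unfolding bi_vector_def by (intro sum.cong refl path_sum_snoc) (use assms in auto)
  also have "\<dots> = (\<Sum>g\<in>bi_spins r. \<Sum>x\<in>?S. path_sum ?w (bi_spins r) ls x g * ?w l g y)"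
    by (rule sum.swap)
  also have "\<dots> = (\<Sum>g\<in>bi_spins r. bi_vector ls g * ?w l g y)"
    by (simp only: bi_vector_def sum_distrib_right)
  finally show ?thesis by (simp only: sum_bi_spins)
qed

lemma bi_vector_snoc_Color:
  assumes "c \<in> {1..r}" "d \<in> {1..r}" "a \<in> {1..r}"
  shows "bi_vector (ls @ [(c, d)]) (Color a) =
    (if a = c then bi_vector ls (Color c) * z + bi_vector ls (Dolor d) * (\<Sum>k<T (c, d). t ^ k)
     else bi_vector ls (Color a) * (if a < c then t ^ T (c, d) else 1))"
proof -
  let ?w = "\<lambda>x y. bottomless_weight (bi_unfused t) z (c, d) x y (T (c, d))"
  have "(\<Sum>a'=1..r. bi_vector ls (Color a') * ?w (Color a') (Color a)) = bi_vector ls (Color a) * ?w (Color a) (Color a)"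
    using assms by (intro sum_single) auto
  moreover have "(\<Sum>d'=1..r. bi_vector ls (Dolor d') * ?w (Dolor d') (Color a)) = bi_vector ls (Dolor d) * ?w (Dolor d) (Color a)"
    using assms by (intro sum_single) auto
  ultimately show ?thesis using bi_vector_snoc[of "Color a" ls "(c, d)"] assms by simp
qed

lemma bi_vector_snoc_Dolor:
  assumes "c \<in> {1..r}" "d \<in> {1..r}" "x \<in> {1..r}"
  shows "bi_vector (ls @ [(c, d)]) (Dolor x) =
    (if x = d then bi_vector ls (Dolor d) + bi_vector ls (Color c) * ((1 - t) * z)
     else bi_vector ls (Dolor x) * z ^ (if c = 1 then 1 else 0) * t ^ (if x < d then T (c, d) else 0))"
proof -
  let ?w = "\<lambda>x y. bottomless_weight (bi_unfused t) z (c, d) x y (T (c, d))"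
  have "(\<Sum>a'=1..r. bi_vector ls (Color a') * ?w (Color a') (Dolor x)) = bi_vector ls (Color c) * ?w (Color c) (Dolor x)"
    using assms by (intro sum_single) auto
  moreover have "(\<Sum>d'=1..r. bi_vector ls (Dolor d') * ?w (Dolor d') (Dolor x)) = bi_vector ls (Dolor x) * ?w (Dolor x) (Dolor x)"
    using assms by (intro sum_single) auto
  ultimately show ?thesis using bi_vector_snoc[of "Dolor x" ls "(c, d)"] assms by simp
qed

text \<open>\<open>n a\<close> counts the bosons of color \<open>a\<close> read so far. Before the
  first block, at \<open>d = r\<close>, the division by \<open>z\<close> turns
  \<open>transfer\<close> into the indicator of the left spin. At \<open>d = 0\<close> all entries
  share the factor \<open>z ^ r / z\<close>. The counts \<open>0 0\<close> are dummies, as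
  \<open>transfer\<close> to \<open>Plus\<close> ignores them.\<close>

definition after_blocks :: "(nat \<times> nat) list \<Rightarrow> nat \<Rightarrow> (nat \<Rightarrow> nat) \<Rightarrow> bool" where
  "after_blocks ls d n \<longleftrightarrow>
     (\<forall>a\<in>{1..r}. bi_vector ls (Color a) = z ^ (r - d) * transfer t z X (Particle a) (n a) (\<Sum>b\<in>{a<..r}. n b) / z) \<and>
     (\<forall>x\<in>{d<..r}. bi_vector ls (Dolor x) = z ^ (r - d) * transfer t z X Plus 0 0 / z) \<and>
     (\<forall>x\<in>{1..d}. bi_vector ls (Dolor x) = of_bool (X = Plus) * z ^ (r - d) * t ^ (\<Sum>b=1..r. n b))"

text \<open>This interpolates between \<open>after_blocks\<close> for \<open>d\<close> and for
  \<open>d - 1\<close>. The new factor \<open>z\<close> reaches a color at its own label and each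
  dolor other than \<open>d\<close> at the first label. The entry of \<open>d\<close> itself moves
  from the value of a dolor still to be read, at \<open>c = 0\<close>, to that of one already read,
  at \<open>c = r\<close>.\<close>

definition inside_block :: "(nat \<times> nat) list \<Rightarrow> nat \<Rightarrow> nat \<Rightarrow> (nat \<Rightarrow> nat) \<Rightarrow> bool" where
  "inside_block ls d c n \<longleftrightarrow>
     (\<forall>a\<in>{1..r}. bi_vector ls (Color a) =
        z ^ (r - d) * transfer t z X (Particle a) (n a) (\<Sum>b\<in>{a<..r}. n b) * (if a \<le> c then 1 else inverse z)) \<and>
     (\<forall>x\<in>{d<..r}. bi_vector ls (Dolor x) = z ^ (r - d) * transfer t z X Plus 0 0 * (if 1 \<le> c then 1 else inverse z)) \<and>
     (\<forall>x\<in>{1..<d}. bi_vector ls (Dolor x) =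
        of_bool (X = Plus) * z ^ (r - d) * (if 1 \<le> c then z else 1) * t ^ (\<Sum>b=1..r. n b)) \<and>
     bi_vector ls (Dolor d) = z ^ (r - d) * (t ^ (\<Sum>b\<in>{c<..r}. n b) * released t z X c)"

text \<open>The vertex mixes only the entries of color \<open>Suc c\<close> and dolor
  \<open>d\<close>: the first is updated by \<open>transfer_add_same\<close>, the second by
  \<open>released_Suc\<close>. The remaining entries are multiplied by a power of \<open>z\<close>
  or \<open>t\<close>.\<close>

lemma inside_block_step:
  assumes d: "d \<in> {1..r}" and c: "Suc c \<in> {1..r}" and inv: "inside_block ls d c n"
  shows "inside_block (ls @ [(Suc c, d)]) d (Suc c) (n(Suc c := n (Suc c) + T (Suc c, d)))"
proof -
  let ?m = "T (Suc c, d)" and ?ls = "ls @ [(Suc c, d)]"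
  let ?n = "n(Suc c := n (Suc c) + ?m)"
  \<comment> \<open>Reading \<open>Suc c\<close> changes the number of larger bosons only for the
    colors below it.\<close>
  have above: "(\<Sum>b\<in>{a<..r}. ?n b) = (\<Sum>b\<in>{a<..r}. n b) + (if a \<le> c then ?m else 0)" for a
  proof (cases "a \<le> c")
    case True
    then have "{a<..r} = insert (Suc c) ({a<..r} - {Suc c})" using c by auto
    then have "(\<Sum>b\<in>{a<..r}. f b) = f (Suc c) + (\<Sum>b\<in>{a<..r} - {Suc c}. f b)" for f :: "nat \<Rightarrow> nat"
      by (metis finite_greaterThanAtMost sum.remove insertI1)
    moreover have "(\<Sum>b\<in>{a<..r} - {Suc c}. ?n b) = (\<Sum>b\<in>{a<..r} - {Suc c}. n b)"
      by (rule sum.cong) auto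
    ultimately show ?thesis using True by simp
  next
    case False
    then show ?thesis by (auto intro: sum.cong)
  qed
  have all: "(\<Sum>b=1..r. ?n b) = (\<Sum>b=1..r. n b) + ?m"
    using above[of 0] by (simp add: atLeastSucAtMost_greaterThanAtMost)
  have split: "(\<Sum>b\<in>{c<..r}. n b) = n (Suc c) + (\<Sum>b\<in>{Suc c<..r}. n b)"
  proof -
    have "{c<..r} = insert (Suc c) {Suc c<..r}" using c by auto
    then show ?thesis by simp
  qed
  define s where "s = (\<Sum>b\<in>{Suc c<..r}. n b)"
  have color: "bi_vector ls (Color a) =
      z ^ (r - d) * transfer t z X (Particle a) (n a) (\<Sum>b\<in>{a<..r}. n b) * (if a \<le> c then 1 else inverse z)"
    if "a \<in> {1..r}" for a using inv that by (simp add: inside_block_def)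
  have dolor: "bi_vector ls (Dolor d) = z ^ (r - d) * (t ^ (n (Suc c) + s) * released t z X c)"
    using inv by (simp add: inside_block_def split s_def)
  have color_c: "bi_vector ls (Color (Suc c)) = z ^ (r - d) * transfer t z X (Particle (Suc c)) (n (Suc c)) s * inverse z"
    using color[OF c] by (simp add: s_def)
  have 1: "bi_vector ?ls (Color a) =
        z ^ (r - d) * transfer t z X (Particle a) (?n a) (\<Sum>b\<in>{a<..r}. ?n b) * (if a \<le> Suc c then 1 else inverse z)"
    if a: "a \<in> {1..r}" for a
  proof -
    consider "a \<le> c" | "a = Suc c" | "a > Suc c" by linarith
    then show ?thesis
    proof cases
      case 1
      then show ?thesis
        using above[of a] bi_vector_snoc_Color[OF c d a] color[OF a] by (simp add: transfer_add_above)
    next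
      case 2
      have "bi_vector ?ls (Color (Suc c)) =
          z ^ (r - d) * (transfer t z X (Particle (Suc c)) (n (Suc c)) s
            + (\<Sum>k<?m. t ^ k) * (t ^ (n (Suc c) + s) * released t z X c))"
        using z by (simp add: bi_vector_snoc_Color[OF c d c] color_c dolor algebra_simps)
      then show ?thesis
        using 2 above[of "Suc c"] by (simp only: transfer_add_same[symmetric]) (simp add: s_def)
    next
      case 3
      then show ?thesis
        using above[of a] bi_vector_snoc_Color[OF c d a] color[OF a] by simp
    qed
  qed
  have "bi_vector ?ls (Dolor x) = z ^ (r - d) * transfer t z X Plus 0 0" if x: "x \<in> {d<..r}" for x
  proof -
    have "bi_vector ls (Dolor x) = z ^ (r - d) * transfer t z X Plus 0 0 * (if 1 \<le> c then 1 else inverse z)"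
      using inv x by (simp add: inside_block_def)
    then show ?thesis using x d z bi_vector_snoc_Dolor[OF c d, of x ls] by auto
  qed
  moreover have "bi_vector ?ls (Dolor x) = of_bool (X = Plus) * z ^ (r - d) * z * t ^ (\<Sum>b=1..r. ?n b)"
    if x: "x \<in> {1..<d}" for x
  proof -
    have "bi_vector ls (Dolor x) =
        of_bool (X = Plus) * z ^ (r - d) * (if 1 \<le> c then z else 1) * t ^ (\<Sum>b=1..r. n b)"
      using inv x by (simp add: inside_block_def)
    then show ?thesis using x d bi_vector_snoc_Dolor[OF c d, of x ls] unfolding all
      by (auto simp: power_add)
  qed
  moreover have "bi_vector ?ls (Dolor d) = z ^ (r - d) * (t ^ (\<Sum>b\<in>{Suc c<..r}. ?n b) * released t z X (Suc c))"
  proof -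
    have "bi_vector ?ls (Dolor d) = z ^ (r - d) * (t ^ (n (Suc c) + s) * released t z X c
        + (1 - t) * transfer t z X (Particle (Suc c)) (n (Suc c)) s)"
    proof -
      \<comment> \<open>The \<open>z\<close> in the weight of a color turning into a dolor cancels
        the \<open>inverse z\<close> still carried by the entry of \<open>Suc c\<close>.\<close>
      have "bi_vector ls (Color (Suc c)) * ((1 - t) * z) = (bi_vector ls (Color (Suc c)) * z) * (1 - t)"
        by (simp only: mult_ac)
      also have "bi_vector ls (Color (Suc c)) * z = z ^ (r - d) * transfer t z X (Particle (Suc c)) (n (Suc c)) s"
        using z by (simp add: color_c)
      finally have "bi_vector ls (Color (Suc c)) * ((1 - t) * z) =
          z ^ (r - d) * ((1 - t) * transfer t z X (Particle (Suc c)) (n (Suc c)) s)"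
        by (simp only: mult_ac)
      then show ?thesis
        using bi_vector_snoc_Dolor[OF c d d, of ls] dolor by (simp only: distrib_left if_True refl)
    qed
    then show ?thesis using above[of "Suc c"] by (simp only: released_Suc) (simp add: s_def)
  qed
  ultimately show ?thesis unfolding inside_block_def using 1 by simp
qed

text \<open>\<open>after_blocks\<close> supplies the case \<open>c = 0\<close> of
  \<open>inside_block\<close>, and the case \<open>c = r\<close> gives it back one dolor further: by
  \<open>released_transfer\<close> the entry of \<open>Suc d\<close> then joins those of the dolors
  already read.\<close>

lemma after_blocks_step:
  assumes d: "Suc d \<le> r" and inv: "after_blocks ls (Suc d) n"
  shows "after_blocks (ls @ block (Suc d) r) d (\<lambda>a. n a + (if a \<in> {1..r} then T (a, Suc d) else 0))"
proof -
  have "inside_block (ls @ block (Suc d) c) (Suc d) c (\<lambda>a. n a + (if a \<in> {1..c} then T (a, Suc d) else 0))"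
    if "c \<le> r" for c
    using that
  proof (induction c)
    case 0
    have "released t z X 0 = of_bool (X = Plus)" using X by auto
    then show ?case
      using inv d unfolding inside_block_def after_blocks_def
      by (simp add: divide_inverse atLeastSucAtMost_greaterThanAtMost)
  next
    case (Suc c)
    define m where "m c = (\<lambda>a. n a + (if a \<in> {1..c} then T (a, Suc d) else 0))" for c
    have "m (Suc c) = (m c)(Suc c := m c (Suc c) + T (Suc c, Suc d))"
      by (auto simp: m_def fun_eq_iff)
    moreover have "inside_block ((ls @ block (Suc d) c) @ [(Suc c, Suc d)]) (Suc d) (Suc c)
        ((m c)(Suc c := m c (Suc c) + T (Suc c, Suc d)))"
      by (rule inside_block_step) (use Suc d in \<open>auto simp only: m_def atLeastAtMost_iff\<close>)
    ultimately show ?case by (simp add: m_def)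
  qed
  from this[of r] have inside: "inside_block (ls @ block (Suc d) r) (Suc d) r
      (\<lambda>a. n a + (if a \<in> {1..r} then T (a, Suc d) else 0))" (is "inside_block ?ls _ _ ?n")
    by simp
  have zd: "z ^ (r - d) = z * z ^ (r - Suc d)"
    using d by (simp flip: Suc_diff_Suc)
  show ?thesis
    unfolding after_blocks_def
  proof (intro conjI ballI)
    fix a assume "a \<in> {1..r}"
    then show "bi_vector ?ls (Color a) = z ^ (r - d) * transfer t z X (Particle a) (?n a) (\<Sum>b\<in>{a<..r}. ?n b) / z"
      using inside z by (simp add: inside_block_def zd)
  next
    fix x assume "x \<in> {d<..r}"
    then consider "x = Suc d" | "x \<in> {Suc d<..r}" by fastforce
    then show "bi_vector ?ls (Dolor x) = z ^ (r - d) * transfer t z X Plus 0 0 / z"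
    proof cases
      case 1
      then show ?thesis
        using inside z released_transfer[OF X, of t z 0 0] by (simp add: inside_block_def zd)
    next
      case 2
      then show ?thesis using inside z d by (simp add: inside_block_def zd)
    qed
  next
    fix x assume "x \<in> {1..d}"
    then show "bi_vector ?ls (Dolor x) = of_bool (X = Plus) * z ^ (r - d) * t ^ (\<Sum>b=1..r. ?n b)"
      using inside d by (simp add: inside_block_def zd)
  qed
qed

text \<open>Downward induction on \<open>d\<close>, because the blocks are read from the largest
  dolor to the smallest.\<close>

lemma after_blocks_all:
  "after_blocks (bi_labels r) 0 (\<lambda>a. if a \<in> {1..r} then \<Sum>d=1..r. T (a, d) else 0)"
proof -
  have "after_blocks (concat (map (\<lambda>d. block d r) (rev [Suc d..<Suc r]))) d
      (\<lambda>a. if a \<in> {1..r} then \<Sum>x\<in>{d<..r}. T (a, x) else 0)" if "d \<le> r" for d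
    using that
  proof (induction d rule: inc_induct)
    case base
    have "bi_vector [] (Color a) = transfer t z X (Particle a) 0 0 / z" if "a \<in> {1..r}" for a
      using that z bi_vector_Nil[of "Color a"] by (cases X) auto
    moreover have "bi_vector [] (Dolor x) = of_bool (X = Plus)" if "x \<in> {1..r}" for x
      using that bi_vector_Nil[of "Dolor x"] by (cases X) auto
    ultimately show ?case by (auto simp: after_blocks_def cong: if_cong)
  next
    case (step d)
    have "{d<..r} = insert (Suc d) {Suc d<..r}" using step by auto
    then have "(\<lambda>a. if a \<in> {1..r} then \<Sum>x\<in>{d<..r}. T (a, x) else 0) =
        (\<lambda>a. (if a \<in> {1..r} then \<Sum>x\<in>{Suc d<..r}. T (a, x) else 0) + (if a \<in> {1..r} then T (a, Suc d) else 0))"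
      by (auto simp: fun_eq_iff)
    moreover have "rev [Suc d..<Suc r] = rev [Suc (Suc d)..<Suc r] @ [Suc d]"
      using step by (simp add: upt_rec)
    ultimately show ?case
      using after_blocks_step[OF _ step.IH] step.hyps by (simp del: upt_Suc)
  qed
  from this[of 0] show ?thesis
    by (simp add: bi_labels_block atLeastSucAtMost_greaterThanAtMost cong: if_cong)
qed

end

text \<open>At \<open>d = 0\<close> every dolor has been read, so all entries have the same power of
  \<open>z\<close> and depend on \<open>y\<close> only through \<open>merge y\<close>.\<close>

lemma sum_path_sum_bi:
  fixes t z :: "'a::field"
  assumes X: "X \<in> col_spins r" and z: "z \<noteq> 0" and y: "y \<in> bi_spins r"
  shows "(\<Sum>x | x \<in> bi_spins r \<and> merge x = X.
      path_sum (\<lambda>l x y. bottomless_weight (bi_unfused t) z l x y (T l)) (bi_spins r) (bi_labels r) x y) =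
    z ^ (r - 1) * path_sum (\<lambda>l x y. bottomless_weight (col_unfused t) z l x y (\<Sum>d=1..r. T (l, d)))
      (col_spins r) [1..<Suc r] X (merge y)"
proof -
  have "r \<ge> 1" using y by auto
  then have zr: "z ^ (r - 1) = z ^ r / z" using z by (cases r) auto
  have y': "merge y \<in> col_spins r" using y by auto
  have "bi_vector t z r X T (bi_labels r) y = z ^ (r - 1) * (case merge y of Plus \<Rightarrow> transfer t z X Plus 0 0
      | Particle b \<Rightarrow> transfer t z X (Particle b) (\<Sum>d=1..r. T (b, d)) (\<Sum>a\<in>{b<..r}. \<Sum>d=1..r. T (a, d)))"
    using after_blocks_all[OF X z, of t T] y unfolding after_blocks_def[OF X z] zr
    by (auto intro!: arg_cong2[where f = "transfer t z X (Particle _)"] sum.cong)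
  then show ?thesis unfolding path_sum_col[OF X y'] bi_vector_def[OF X z] .
qed

subsection \<open>Forgetting the dolors\<close>

lemma set_bi_labels: "set (bi_labels r) = {1..r} \<times> {1..r}"
  by (force simp: bi_labels_def simp del: upt_Suc)

lemma distinct_bi_labels: "distinct (bi_labels r)"
proof -
  have "distinct (concat (map (\<lambda>d. map (\<lambda>c. (c, d)) cs) ds))" if "distinct cs" "distinct ds"
    for cs ds :: "nat list"
    using that by (induction ds) (auto simp: distinct_map inj_on_def)
  then show ?thesis by (simp add: bi_labels_def del: upt_Suc)
qed

definition merge_bottom :: "nat \<Rightarrow> (nat \<times> nat \<Rightarrow> nat) \<Rightarrow> nat \<Rightarrow> nat" where
  "merge_bottom r B = (\<lambda>c\<in>{1..r}. \<Sum>d=1..r. B (c, d))"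

lemma merge_bottom_extensional [simp]: "merge_bottom r B \<in> extensional {1..r}"
  by (simp add: merge_bottom_def)

lemma le_merge_bottom:
  assumes "c \<in> {1..r}" "d \<in> {1..r}"
  shows "B (c, d) \<le> merge_bottom r B c"
  using assms member_le_sum[of d "{1..r}" "\<lambda>d. B (c, d)"] by (simp add: merge_bottom_def)

text \<open>The number of bosons of a color bounds each of its multiplicities; hence the fibres of
  \<open>merge_bottom\<close> are finite.\<close>

lemma finite_merge_bottom_le:
  "finite {B \<in> extensional (set (bi_labels r)). \<forall>c\<in>{1..r}. merge_bottom r B c \<le> b c}"
proof (rule finite_subset)
  show "{B \<in> extensional (set (bi_labels r)). \<forall>c\<in>{1..r}. merge_bottom r B c \<le> b c}
      \<subseteq> (\<Pi>\<^sub>E l\<in>set (bi_labels r). {..b (fst l)})"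
  proof
    fix B assume B: "B \<in> {B \<in> extensional (set (bi_labels r)). \<forall>c\<in>{1..r}. merge_bottom r B c \<le> b c}"
    have "B l \<le> b (fst l)" if "l \<in> set (bi_labels r)" for l
      using that B le_merge_bottom[of "fst l" r "snd l" B] by (force simp: set_bi_labels)
    with B show "B \<in> (\<Pi>\<^sub>E l\<in>set (bi_labels r). {..b (fst l)})" by (auto simp: PiE_iff)
  qed
qed (auto intro: finite_PiE)

lemma finite_merge_bottom_eq:
  "finite {B \<in> extensional (set (bi_labels r)). merge_bottom r B = b}"
  by (rule finite_subset[OF _ finite_merge_bottom_le[of r b]]) auto

lemma sum_fst_bi_labels:
  assumes "c \<in> {1..r}"
  shows "(\<Sum>l | l \<in> set (bi_labels r) \<and> fst l = c. B l) = merge_bottom r B c"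
proof -
  have "{l. l \<in> set (bi_labels r) \<and> fst l = c} = (\<lambda>d. (c, d)) ` {1..r}"
    using assms by (auto simp: set_bi_labels)
  then have "(\<Sum>l | l \<in> set (bi_labels r) \<and> fst l = c. B l) = (\<Sum>d=1..r. B (c, d))"
    by (simp add: sum.reindex inj_on_def)
  then show ?thesis using assms by (simp add: merge_bottom_def)
qed

lemma bi_charge_merge: "bi_charge x = col_charge (merge x)"
  by (cases x) auto

text \<open>\<open>sum_vertex_weight_fiber\<close> reduces both sides to bottomless path sums under
  the same condition \<open>?cons\<close>, since merging preserves charges;
  \<open>sum_path_sum_bi\<close> compares these path sums.\<close>

lemma sum_vertex_weight_bi:
  fixes t z :: "'a::field"
  assumes X: "X \<in> col_spins r" and z: "z \<noteq> 0" and y: "y \<in> bi_spins r" and b: "b \<in> extensional {1..r}"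
  shows "(\<Sum>(x, B)\<in>{x \<in> bi_spins r. merge x = X} \<times> {B \<in> extensional (set (bi_labels r)). merge_bottom r B = b}.
      vertex_weight (bi_unfused t) (bi_labels r) (bi_spins r) z x y T B) =
    z ^ (r - 1) * vertex_weight (col_unfused t) [1..<Suc r] (col_spins r) z X (merge y) (merge_bottom r T) b"
proof -
  interpret bi: charged_weights "bi_unfused t" "bi_spins r" fst bi_charge by (rule bi_charged_weights)
  interpret col: charged_weights "col_unfused t" "col_spins r" "\<lambda>c. c" col_charge by (rule col_charged_weights)
  let ?C = "{B \<in> extensional (set (bi_labels r)). merge_bottom r B = b}"
  let ?cons = "\<forall>c\<in>{1..r}. of_bool (col_charge (merge y) = Some c) + b c =
    of_bool (col_charge X = Some c) + merge_bottom r T c"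
  have ext_eq: "B = b \<longleftrightarrow> (\<forall>c\<in>{1..r}. B c = b c)" if "B \<in> extensional {1..r}" for B
    using that b by (metis extensionalityI)
  have colors: "fst ` set (bi_labels r) = {1..r}" by (auto simp: set_bi_labels)
  have fiber: "(\<Sum>B\<in>?C. vertex_weight (bi_unfused t) (bi_labels r) (bi_spins r) z x y T B) =
      (if ?cons then path_sum (\<lambda>l x y. bottomless_weight (bi_unfused t) z l x y (T l)) (bi_spins r) (bi_labels r) x y else 0)"
    if "x \<in> bi_spins r" "merge x = X" for x
  proof -
    have "B \<in> ?C \<longleftrightarrow> B \<in> extensional (set (bi_labels r)) \<and>
        (\<forall>c\<in>fst ` set (bi_labels r). (\<Sum>l | l \<in> set (bi_labels r) \<and> fst l = c. B l) = b c)" for B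
      by (simp only: colors mem_Collect_eq ext_eq[OF merge_bottom_extensional] sum_fst_bi_labels cong: ball_cong)
    from bi.sum_vertex_weight_fiber[OF distinct_bi_labels that(1) finite_merge_bottom_eq this]
    show ?thesis
      by (simp only: colors bi_charge_merge that(2) sum_fst_bi_labels cong: ball_cong)
  qed
  let ?S = "{x \<in> bi_spins r. merge x = X}"
  have sum_if: "(\<Sum>x\<in>S. if P then f x else 0) = (if P then sum f S else 0)" for S P and f :: "bi_spin \<Rightarrow> 'a"
    by simp
  have "(\<Sum>(x, B)\<in>?S \<times> ?C. vertex_weight (bi_unfused t) (bi_labels r) (bi_spins r) z x y T B) =
      (\<Sum>x\<in>?S. \<Sum>B\<in>?C. vertex_weight (bi_unfused t) (bi_labels r) (bi_spins r) z x y T B)"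
    by (rule sum.cartesian_product[symmetric])
  also have "\<dots> = (\<Sum>x\<in>?S. if ?cons then path_sum (\<lambda>l x y. bottomless_weight (bi_unfused t) z l x y (T l))
      (bi_spins r) (bi_labels r) x y else 0)"
    by (intro sum.cong refl fiber) blast+
  also have "\<dots> = (if ?cons then \<Sum>x\<in>?S. path_sum (\<lambda>l x y. bottomless_weight (bi_unfused t) z l x y (T l))
      (bi_spins r) (bi_labels r) x y else 0)"
    by (rule sum_if)
  also have "\<dots> = (if ?cons then z ^ (r - 1) * path_sum (\<lambda>l x y. bottomless_weight (col_unfused t) z l x y
      (\<Sum>d=1..r. T (l, d))) (col_spins r) [1..<Suc r] X (merge y) else 0)"
    by (simp only: sum_path_sum_bi[OF X z y])
  also have "path_sum (\<lambda>l x y. bottomless_weight (col_unfused t) z l x y (\<Sum>d=1..r. T (l, d)))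
      (col_spins r) [1..<Suc r] X (merge y) =
    path_sum (\<lambda>l x y. bottomless_weight (col_unfused t) z l x y (merge_bottom r T l)) (col_spins r) [1..<Suc r] X (merge y)"
    by (intro path_sum_cong) (auto simp: merge_bottom_def simp del: upt_Suc)
  also have "(if ?cons then z ^ (r - 1) * \<dots> else 0) = z ^ (r - 1) * (if ?cons then \<dots> else 0)"
    by (simp only: if_distrib[where f = "(*) (z ^ (r - 1))"] mult_zero_right)
  also have "(if ?cons then path_sum (\<lambda>l x y. bottomless_weight (col_unfused t) z l x y (merge_bottom r T l))
      (col_spins r) [1..<Suc r] X (merge y) else 0) =
    vertex_weight (col_unfused t) [1..<Suc r] (col_spins r) z X (merge y) (merge_bottom r T) b"
  proof -
    have set: "set [1..<Suc r] = {1..r}" by auto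
    have single: "(\<Sum>l | l \<in> {1..r} \<and> l = c. B l) = B c" if "c \<in> {1..r}" for B :: "nat \<Rightarrow> nat" and c
    proof -
      have "{l. l \<in> {1..r} \<and> l = c} = {c}" using that by auto
      then show ?thesis by simp
    qed
    \<comment> \<open>In the colored model the projection is the identity, so the fibre over
      \<open>b\<close> is a single configuration.\<close>
    have "B \<in> {b} \<longleftrightarrow> B \<in> extensional (set [1..<Suc r]) \<and>
        (\<forall>c\<in>(\<lambda>c. c) ` set [1..<Suc r]. (\<Sum>l | l \<in> set [1..<Suc r] \<and> l = c. B l) = b c)" for B
      unfolding set image_ident singleton_iff using b ext_eq by (simp only: single cong: ball_cong) blast
    from col.sum_vertex_weight_fiber[OF distinct_upt X _ this, of z "merge y" "merge_bottom r T"]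
    show ?thesis
      unfolding set image_ident by (simp only: single finite.intros sum.insert sum.empty empty_iff not_False_eq_True add_0_right cong: ball_cong)
  qed
  finally show ?thesis .
qed

section \<open>Conservation of dolors on the grid\<close>

lemma grid_conservation:
  fixes h v :: "nat \<Rightarrow> nat \<Rightarrow> int"
  assumes "\<And>i j. i < r \<Longrightarrow> j < N \<Longrightarrow> v (Suc i) j + h i (Suc j) = v i j + h i j"
  shows "(\<Sum>j<N. v r j) + (\<Sum>i<r. h i N) = (\<Sum>j<N. v 0 j) + (\<Sum>i<r. h i 0)"
proof -
  \<comment> \<open>The local balances are summed over the grid; vertical differences telescope
    along columns and horizontal ones along rows.\<close>
  have "0 = (\<Sum>i<r. \<Sum>j<N. (v (Suc i) j - v i j) + (h i (Suc j) - h i j))"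
    using assms by (intro sum.neutral[symmetric] ballI) (force simp: algebra_simps)
  also have "\<dots> = (\<Sum>i<r. \<Sum>j<N. v (Suc i) j - v i j) + (\<Sum>i<r. \<Sum>j<N. h i (Suc j) - h i j)"
    by (simp only: sum.distrib)
  also have "(\<Sum>i<r. \<Sum>j<N. v (Suc i) j - v i j) = (\<Sum>j<N. \<Sum>i<r. v (Suc i) j - v i j)"
    by (rule sum.swap)
  also have "\<dots> = (\<Sum>j<N. v r j - v 0 j)"
    by (intro sum.cong refl) (rule sum_lessThan_telescope)
  also have "(\<Sum>i<r. \<Sum>j<N. h i (Suc j) - h i j) = (\<Sum>i<r. h i N - h i 0)"
    by (intro sum.cong refl) (rule sum_lessThan_telescope)
  finally show ?thesis by (simp add: sum_subtractf)
qed

text \<open>A boson that leaves its column sends its color to the right and its dolor to the left.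
  Hence the negative potential for horizontal dolors in the balance.\<close>

lemma vertex_weight_dolor_conservation:
  assumes "vertex_weight (bi_unfused t) (bi_labels r) (bi_spins r) z x y T B \<noteq> 0"
    and "x \<in> bi_spins r" and d: "d \<in> {1..r}"
  shows "(\<Sum>c=1..r. int (B (c, d))) + of_bool (x = Dolor d) = (\<Sum>c=1..r. int (T (c, d))) + of_bool (y = Dolor d)"
proof -
  interpret charged_weights "bi_unfused t" "bi_spins r" fst bi_charge by (rule bi_charged_weights)
  have "path_sum (\<lambda>l x y. total_weight (bi_unfused t) z l x y (T l) (B l)) (bi_spins r) (bi_labels r) x y \<noteq> 0"
    using assms vertex_weight_path_sum by simp
  then have "- of_bool (y = Dolor d) + (\<Sum>l\<leftarrow>bi_labels r. of_bool (snd l = d) * int (B l)) =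
      - of_bool (x = Dolor d) + (\<Sum>l\<leftarrow>bi_labels r. of_bool (snd l = d) * int (T l))"
  proof (rule path_sum_conservation)
    fix z l x y m n assume "bi_unfused t z l x y m n \<noteq> None"
    then show "- of_bool (y = Dolor d) + of_bool (snd l = d) * int n =
        - of_bool (x = Dolor d) + of_bool (snd l = d) * int m"
      by (cases l; cases x; cases y) (auto split: if_splits)
  qed
  moreover have "(\<Sum>l\<leftarrow>bi_labels r. of_bool (snd l = d) * int (B l)) = (\<Sum>c=1..r. int (B (c, d)))" for B
  proof -
    have "(\<Sum>l\<leftarrow>bi_labels r. of_bool (snd l = d) * int (B l)) =
        (\<Sum>c=1..r. \<Sum>d'=1..r. of_bool (d' = d) * int (B (c, d')))"
      unfolding sum_list_distinct_conv_sum_set[OF distinct_bi_labels] set_bi_labels sum.cartesian_product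
      by (rule sum.cong) auto
    also have "\<dots> = (\<Sum>c=1..r. of_bool (d = d) * int (B (c, d)))"
      using d by (intro sum.cong refl sum_single) auto
    finally show ?thesis by simp
  qed
  ultimately show ?thesis by simp
qed

lemma sum_card_fibers:
  assumes "finite A" "finite D" "g ` A \<subseteq> D"
  shows "(\<Sum>d\<in>D. card {i \<in> A. g i = d}) = card A"
  using sum.group[OF assms, of "\<lambda>_. 1::nat"] by simp

text \<open>Fibres of size one make \<open>f\<close> a bijection of \<open>A\<close>, which the
  identity extends to a permutation. It is matched with \<open>inv w\<close> because the boundary
  spins are indexed by inverses.\<close>

lemma ex1_permutation:
  assumes "finite A" "f \<in> A \<rightarrow> A" "\<And>d. d \<in> A \<Longrightarrow> card {i \<in> A. f i = d} = 1"
  shows "\<exists>!w. w permutes A \<and> (\<forall>i\<in>A. inv w i = f i)"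
proof -
  define g where "g = (\<lambda>i. if i \<in> A then f i else i)"
  have "A \<subseteq> f ` A"
  proof
    fix d assume "d \<in> A"
    then have "{i \<in> A. f i = d} \<noteq> {}" using assms(3) by (metis card.empty zero_neq_one)
    then show "d \<in> f ` A" by auto
  qed
  then have im: "f ` A = A" using assms(2) by auto
  then have "inj_on f A" using assms(1) by (simp add: eq_card_imp_inj_on)
  with im have "bij_betw g A A" by (auto simp: bij_betw_def g_def inj_on_def)
  then have g: "g permutes A" by (rule bij_imp_permutes) (simp add: g_def)
  show ?thesis
  proof (rule ex1I[of _ "inv g"])
    show "inv g permutes A \<and> (\<forall>i\<in>A. inv (inv g) i = f i)"
      using g by (simp add: permutes_inv permutes_inv_inv) (simp add: g_def)
  next
    fix w assume w: "w permutes A \<and> (\<forall>i\<in>A. inv w i = f i)"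
    have "inv w i = g i" for i
      using w permutes_not_in[OF permutes_inv[of w A], of i] by (auto simp: g_def)
    then have "inv w = g" by blast
    then show "w = inv g" using w permutes_inv_inv by metis
  qed
qed

section \<open>The bicolored grid above a colored state\<close>

lemma merge_bottom_eq_0_iff:
  assumes "B \<in> extensional (set (bi_labels r))"
  shows "merge_bottom r B = (\<lambda>c\<in>{1..r}. 0) \<longleftrightarrow> B = (\<lambda>l\<in>set (bi_labels r). 0)"
proof
  assume *: "merge_bottom r B = (\<lambda>c\<in>{1..r}. 0)"
  have "B (c, d) = 0" if "c \<in> {1..r}" "d \<in> {1..r}" for c d
    using le_merge_bottom[OF that, of B] that(1) by (simp add: *)
  then show "B = (\<lambda>l\<in>set (bi_labels r). 0)"
    using assms by (intro extensionalityI[of _ "set (bi_labels r)"]) (auto simp: set_bi_labels)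
next
  assume "B = (\<lambda>l\<in>set (bi_labels r). 0)"
  then show "merge_bottom r B = (\<lambda>c\<in>{1..r}. 0)"
    by (intro extensionalityI[of _ "{1..r}"]) (auto simp: merge_bottom_def set_bi_labels)
qed

lemma merge_eq_Plus_iff:
  assumes "x \<in> bi_spins r"
  shows "merge x = Plus \<longleftrightarrow> x \<in> Dolor ` {1..r}"
  using assms by auto

lemma merge_spin: "x \<in> bi_spins r \<Longrightarrow> merge x \<in> col_spins r"
  by auto

definition bi_bottoms :: "nat \<Rightarrow> (nat \<Rightarrow> nat) set \<Rightarrow> (nat \<times> nat \<Rightarrow> nat) set" where
  "bi_bottoms r V = {B \<in> extensional (set (bi_labels r)). merge_bottom r B \<in> V}"

lemma finite_bi_bottoms:
  assumes "finite V"
  shows "finite (bi_bottoms r V)"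
proof -
  have "bi_bottoms r V = (\<Union>b\<in>V. {B \<in> extensional (set (bi_labels r)). merge_bottom r B = b})"
    by (auto simp: bi_bottoms_def)
  then show ?thesis using assms finite_merge_bottom_eq by simp
qed

definition merge_output :: "nat \<Rightarrow> bi_spin \<times> (nat \<times> nat \<Rightarrow> nat) \<Rightarrow> col_spin \<times> (nat \<Rightarrow> nat)" where
  "merge_output r = (\<lambda>(x, B). (merge x, merge_bottom r B))"

abbreviation "bi_outputs r N V \<equiv>
  outputs r N (bi_spins r) (\<lambda>i. Dolor ` {1..r}) (bi_bottoms r V) (\<lambda>l\<in>set (bi_labels r). 0)"

abbreviation "col_outputs r N V \<equiv>
  outputs r N (col_spins r) (\<lambda>i. {Plus}) V (\<lambda>c\<in>{1..r}. 0)"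

text \<open>The boundary conditions are full preimages under merging: a configuration is empty
  exactly if its image is, and a left spin is a dolor exactly if its image is \<open>+\<close>. So
  the outputs above a colored one form a product of two fibres.\<close>

lemma bi_output_iff:
  "y \<in> bi_outputs r N V p \<longleftrightarrow>
     fst y \<in> bi_spins r \<and> snd y \<in> extensional (set (bi_labels r)) \<and> merge_output r y \<in> col_outputs r N V p"
proof -
  obtain x B i j where y: "y = (x, B)" and p: "p = (i, j)" by (cases y; cases p)
  have "x \<in> (if Suc j = N then Dolor ` {1..r} else bi_spins r) \<longleftrightarrow>
      x \<in> bi_spins r \<and> merge x \<in> (if Suc j = N then {Plus} else col_spins r)"
    using merge_eq_Plus_iff[of x r] merge_spin[of x r] by (simp only: singleton_iff split: if_split) blast
  moreover have "B \<in> (if i = r then {\<lambda>l\<in>set (bi_labels r). 0} else bi_bottoms r V) \<longleftrightarrow>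
      B \<in> extensional (set (bi_labels r)) \<and> merge_bottom r B \<in> (if i = r then {\<lambda>c\<in>{1..r}. 0} else V)"
    using merge_bottom_eq_0_iff[of B r] by (auto simp: bi_bottoms_def)
  ultimately show ?thesis
    unfolding y p outputs_def merge_output_def prod.case mem_Times_iff fst_conv snd_conv by blast
qed

text \<open>Bicolored functions are grouped by their images. Within a group the images of all right
  and top edges are fixed, and by \<open>sum_vertex_weight_bi\<close> the local sums depend on
  nothing else, as sequential elimination demands.\<close>

lemma sum_grid_weight_bi:
  fixes t :: "'a::field"
  assumes R: "\<And>i. i \<in> {1..r} \<Longrightarrow> R i \<in> bi_spins r" and z: "\<And>i. i \<in> {1..r} \<Longrightarrow> z i \<noteq> 0"
    and V: "finite V" "V \<subseteq> extensional {1..r}"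
  shows "(\<Sum>s\<in>Pi\<^sub>E ({1..r} \<times> {..<N}) (bi_outputs r N V).
      grid_weight (bi_unfused t) (bi_labels r) (bi_spins r) r N z R T s) =
    (\<Prod>p\<in>{1..r} \<times> {..<N}. z (fst p) ^ (r - 1)) *
    (\<Sum>s\<in>Pi\<^sub>E ({1..r} \<times> {..<N}) (col_outputs r N V).
      grid_weight (col_unfused t) [1..<Suc r] (col_spins r) r N z (\<lambda>i. merge (R i)) (\<lambda>j. merge_bottom r (T j)) s)"
proof -
  let ?P = "{1..r} \<times> {..<N}" and ?F = "bi_outputs r N V" and ?G = "col_outputs r N V"
  let ?b = "\<lambda>p x y T B. vertex_weight (bi_unfused t) (bi_labels r) (bi_spins r) (z (fst p)) x y T B"
  let ?c = "\<lambda>p x y T B. vertex_weight (col_unfused t) [1..<Suc r] (col_spins r) (z (fst p)) x y T B"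
  let ?R = "\<lambda>i. merge (R i)" and ?T = "\<lambda>j. merge_bottom r (T j)"
  let ?\<phi> = "merge_output r"
  have "(\<Sum>s\<in>Pi\<^sub>E ?P ?F. grid_weight (bi_unfused t) (bi_labels r) (bi_spins r) r N z R T s) =
      (\<Sum>s'\<in>Pi\<^sub>E ?P ?G. \<Sum>s\<in>(\<Pi>\<^sub>E p\<in>?P. {y \<in> ?F p. ?\<phi> y = s' p}).
        grid_weight (bi_unfused t) (bi_labels r) (bi_spins r) r N z R T s)"
  proof (rule sum_PiE_fibers)
    show "finite (?F p)" if "p \<in> ?P" for p
      using that V(1) by (intro finite_outputs finite_bi_bottoms) auto
    show "finite (?G p)" if "p \<in> ?P" for p
      using that V(1) by (intro finite_outputs) auto
    show "?\<phi> y \<in> ?G p" if "y \<in> ?F p" for p y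
      using that by (simp only: bi_output_iff)
  qed simp
  also have "\<dots> = (\<Sum>s'\<in>Pi\<^sub>E ?P ?G. \<Prod>p\<in>?P. z (fst p) ^ (r - 1) *
      ?c p (fst (s' p)) (right_edge ?R s' p) (top_edge ?T s' p) (snd (s' p)))"
  proof (rule sum.cong[OF refl])
    fix s' assume s': "s' \<in> Pi\<^sub>E ?P ?G"
    define F where "F = (\<lambda>p. {y \<in> ?F p. ?\<phi> y = s' p})"
    \<comment> \<open>A vertex reads the left spin of its right neighbour and the bottom of its
      upper one; both have smaller \<open>i + j\<close>.\<close>
    define inputs where "inputs = (\<lambda>(i, j). (if j = 0 then {} else {(i, j - 1)}) \<union> (if i = 1 then {} else {(i - 1, j)}) :: (nat \<times> nat) set)"
    have F: "F p = {x \<in> bi_spins r. merge x = fst (s' p)} \<times>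
        {B \<in> extensional (set (bi_labels r)). merge_bottom r B = snd (s' p)}" if "p \<in> ?P" for p
    proof -
      have "s' p \<in> ?G p" using s' that by (rule PiE_mem)
      then have "y \<in> F p \<longleftrightarrow> fst y \<in> bi_spins r \<and> snd y \<in> extensional (set (bi_labels r)) \<and> ?\<phi> y = s' p" for y
        unfolding F_def mem_Collect_eq bi_output_iff by metis
      then show ?thesis by (intro set_eqI) (simp only: mem_Times_iff mem_Collect_eq merge_output_def case_prod_beta prod_eq_iff fst_conv snd_conv, blast)
    qed
    show "(\<Sum>s\<in>(\<Pi>\<^sub>E p\<in>?P. {y \<in> ?F p. ?\<phi> y = s' p}).
        grid_weight (bi_unfused t) (bi_labels r) (bi_spins r) r N z R T s) =
      (\<Prod>p\<in>?P. z (fst p) ^ (r - 1) *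
        ?c p (fst (s' p)) (right_edge ?R s' p) (top_edge ?T s' p) (snd (s' p)))"
      unfolding grid_weight_def F_def[symmetric]
    proof (rule sum_prod_PiE_sequential[where rank = "\<lambda>p. fst p + snd p" and inputs = inputs
        and w = "\<lambda>p s y. ?b p (fst y) (right_edge R s p) (top_edge T s p) (snd y)"])
      fix p :: "nat \<times> nat" and s s' :: "nat \<times> nat \<Rightarrow> bi_spin \<times> (nat \<times> nat \<Rightarrow> nat)" and y
      assume "p \<in> ?P" "\<And>q. q \<in> inputs p \<Longrightarrow> s q = s' q"
      then have "right_edge R s p = right_edge R s' p" "top_edge T s p = top_edge T s' p"
        by (auto simp: inputs_def right_edge_def top_edge_def split: prod.splits if_splits)
      then show "?b p (fst y) (right_edge R s p) (top_edge T s p) (snd y) =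
          ?b p (fst y) (right_edge R s' p) (top_edge T s' p) (snd y)" by simp
    next
      fix p q assume "p \<in> ?P" "q \<in> inputs p"
      then show "q \<in> ?P \<and> fst q + snd q < fst p + snd p"
        by (auto simp: inputs_def split: if_splits)
    next
      fix p s assume p: "p \<in> ?P" and s: "\<And>q. q \<in> inputs p \<Longrightarrow> s q \<in> F q"
      obtain i j where ij: "p = (i, j)" "i \<in> {1..r}" "j < N" using p by auto
      have sF: "fst (s q) \<in> bi_spins r" "merge (fst (s q)) = fst (s' q)" "merge_bottom r (snd (s q)) = snd (s' q)"
        if "q \<in> inputs p" "q \<in> ?P" for q
        using s[OF that(1)] F[OF that(2)] by (auto simp: mem_Times_iff)
      have right: "right_edge R s p \<in> bi_spins r \<and> merge (right_edge R s p) = right_edge ?R s' p"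
      proof (cases "j = 0")
        case True
        then show ?thesis using R[OF ij(2)] by (simp add: right_edge_def ij(1))
      next
        case False
        then have "(i, j - 1) \<in> inputs p" "(i, j - 1) \<in> ?P" using ij by (auto simp: inputs_def)
        from sF(1,2)[OF this] show ?thesis using False by (simp add: right_edge_def ij(1))
      qed
      have top: "merge_bottom r (top_edge T s p) = top_edge ?T s' p"
      proof (cases "i = 1")
        case True
        then show ?thesis by (simp add: top_edge_def ij(1))
      next
        case False
        then have "(i - 1, j) \<in> inputs p" "(i - 1, j) \<in> ?P" using ij by (auto simp: inputs_def)
        from sF(3)[OF this] show ?thesis using False by (simp add: top_edge_def ij(1))
      qed
      have G: "s' p \<in> ?G p" using s' p by (rule PiE_mem)
      then have "fst (s' p) \<in> col_spins r" "snd (s' p) \<in> extensional {1..r}"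
        using V(2) by (auto simp: outputs_def ij(1) split: if_splits)
      moreover have zp: "z (fst p) \<noteq> 0" using z ij by simp
      ultimately have X: "fst (s' p) \<in> col_spins r" "snd (s' p) \<in> extensional {1..r}" by blast+
      from sum_vertex_weight_bi[OF X(1) zp conjunct1[OF right] X(2), of t "top_edge T s p"]
      show "(\<Sum>y\<in>F p. ?b p (fst y) (right_edge R s p) (top_edge T s p) (snd y)) =
          z (fst p) ^ (r - 1) * ?c p (fst (s' p)) (right_edge ?R s' p) (top_edge ?T s' p) (snd (s' p))"
        unfolding F[OF p] by (simp only: right top case_prod_unfold)
    qed simp
  qed
  also have "\<dots> = (\<Prod>p\<in>?P. z (fst p) ^ (r - 1)) *
      (\<Sum>s'\<in>Pi\<^sub>E ?P ?G. grid_weight (col_unfused t) [1..<Suc r] (col_spins r) r N z ?R ?T s')"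
    by (simp only: prod.distrib sum_distrib_left grid_weight_def)
  finally show ?thesis .
qed

text \<open>The right boundary carries colors and the bottom is empty, so the dolors brought in from
  the top must all leave on the left.\<close>

lemma card_left_dolors:
  assumes rN: "r \<ge> 1" "N \<ge> 1"
    and s: "s \<in> Pi\<^sub>E ({1..r} \<times> {..<N}) (bi_outputs r N V)"
    and nz: "grid_weight (bi_unfused t) (bi_labels r) (bi_spins r) r N z (\<lambda>i. Color (R i)) T s \<noteq> 0"
    and d: "d \<in> {1..r}"
  shows "card {i \<in> {1..r}. fst (s (i, N - 1)) = Dolor d} = (\<Sum>j<N. \<Sum>c=1..r. T j (c, d))"
proof -
  let ?R = "right_edge (\<lambda>i. Color (R i)) s" and ?T = "top_edge T s"
  \<comment> \<open>Rows are renumbered from 0; \<open>h i N\<close> then reads the left boundary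
    and \<open>v r j\<close> the bottom one.\<close>
  define h where "h = (\<lambda>i j. of_bool (?R (Suc i, j) = Dolor d) :: int)"
  define v where "v = (\<lambda>i j. \<Sum>c=1..r. int (?T (Suc i, j) (c, d)))"
  have s': "s p \<in> bi_outputs r N V p" if "p \<in> {1..r} \<times> {..<N}" for p
    using s that by (rule PiE_mem)
  have total: "(\<Sum>j<N. v r j) + (\<Sum>i<r. h i N) = (\<Sum>j<N. v 0 j) + (\<Sum>i<r. h i 0)"
  proof (rule grid_conservation)
    fix i j assume "i < r" "j < N"
    then have p: "(Suc i, j) \<in> {1..r} \<times> {..<N}" by auto
    have "vertex_weight (bi_unfused t) (bi_labels r) (bi_spins r) (z (Suc i)) (fst (s (Suc i, j)))
        (?R (Suc i, j)) (?T (Suc i, j)) (snd (s (Suc i, j))) \<noteq> 0"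
      using nz p unfolding grid_weight_def by (auto simp: prod_zero_iff)
    moreover have "fst (s (Suc i, j)) \<in> bi_spins r" using s'[OF p] by (simp only: bi_output_iff)
    ultimately have "(\<Sum>c=1..r. int (snd (s (Suc i, j)) (c, d))) + of_bool (fst (s (Suc i, j)) = Dolor d) =
        v i j + h i j"
      unfolding v_def h_def using d by (rule vertex_weight_dolor_conservation)
    then show "v (Suc i) j + h i (Suc j) = v i j + h i j"
      by (simp add: v_def h_def right_edge_def top_edge_def)
  qed
  have "v r j = 0" if "j < N" for j
  proof -
    have "snd (s (r, j)) = (\<lambda>l\<in>set (bi_labels r). 0)"
      using s'[of "(r, j)"] that rN by (auto simp: outputs_def)
    then show ?thesis using d rN by (auto simp: v_def top_edge_def set_bi_labels)
  qed
  then have bottom: "(\<Sum>j<N. v r j) = 0" by simp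
  have right: "(\<Sum>i<r. h i 0) = 0" by (simp add: h_def right_edge_def)
  have left: "(\<Sum>i<r. h i N) = int (card {i \<in> {1..r}. fst (s (i, N - 1)) = Dolor d})"
  proof -
    have "(\<Sum>i<r. h i N) = (\<Sum>i=1..r. of_bool (fst (s (i, N - 1)) = Dolor d))"
      using rN by (simp add: h_def right_edge_def sum.atLeast1_atMost_eq)
    then show ?thesis by (simp add: Int_def)
  qed
  have top: "(\<Sum>j<N. v 0 j) = int (\<Sum>j<N. \<Sum>c=1..r. T j (c, d))"
    by (simp add: v_def top_edge_def)
  show ?thesis using total unfolding bottom right left top by (simp only: add_0 add_0_right of_nat_eq_iff)
qed

text \<open>After exchanging the sums, a function of nonzero weight has each dolor exactly once on
  its left boundary, by \<open>card_left_dolors\<close>, and so matches exactly one permutation.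
  Functions of weight 0 contribute nothing to either side.\<close>

lemma sum_left_permutations:
  fixes t :: "'a::field" and z :: "nat \<Rightarrow> 'a" and R :: "nat \<Rightarrow> nat"
  assumes rN: "r \<ge> 1" "N \<ge> 1" and V: "finite V"
    and T: "\<And>d. d \<in> {1..r} \<Longrightarrow> (\<Sum>j<N. \<Sum>c=1..r. T j (c, d)) = 1"
  defines "W \<equiv> grid_weight (bi_unfused t) (bi_labels r) (bi_spins r) r N z (\<lambda>i. Color (R i)) T"
  shows "(\<Sum>w | w permutes {1..r}. \<Sum>s\<in>(\<Pi>\<^sub>E p\<in>{1..r} \<times> {..<N}.
      outputs r N (bi_spins r) (\<lambda>i. {Dolor (inv w i)}) (bi_bottoms r V) (\<lambda>l\<in>set (bi_labels r). 0) p). W s) =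
    (\<Sum>s\<in>Pi\<^sub>E ({1..r} \<times> {..<N}) (bi_outputs r N V). W s)"
proof -
  let ?P = "{1..r} \<times> {..<N}" and ?F = "bi_outputs r N V"
  let ?match = "\<lambda>w s. \<forall>i\<in>{1..r}. fst (s (i, N - 1)) = Dolor (inv w i)"
  have fin: "finite (Pi\<^sub>E ?P ?F)"
    using V by (intro finite_PiE finite_outputs finite_bi_bottoms) auto
  have "(\<Pi>\<^sub>E p\<in>?P. outputs r N (bi_spins r) (\<lambda>i. {Dolor (inv w i)}) (bi_bottoms r V) (\<lambda>l\<in>set (bi_labels r). 0) p) =
      {s \<in> Pi\<^sub>E ?P ?F. ?match w s}" (is "?A = ?B") if w: "w permutes {1..r}" for w
  proof (intro equalityI subsetI)
    fix s assume s: "s \<in> ?A"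
    have "s p \<in> ?F p" if "p \<in> ?P" for p
    proof -
      obtain i j where p: "p = (i, j)" "i \<in> {1..r}" using \<open>p \<in> ?P\<close> by auto
      then have "inv w i \<in> {1..r}"
        by (simp only: permutes_in_image[OF permutes_inv[OF w]])
      then have "Dolor (inv w i) \<in> Dolor ` {1..r}" by (rule imageI)
      then show ?thesis
        using PiE_mem[OF s that] unfolding outputs_def p(1) prod.case mem_Times_iff by (metis singletonD)
    qed
    moreover have "?match w s"
    proof
      fix i assume "i \<in> {1..r}"
      then show "fst (s (i, N - 1)) = Dolor (inv w i)"
        using PiE_mem[OF s, of "(i, N - 1)"] rN by (auto simp: outputs_def)
    qed
    ultimately show "s \<in> ?B" using s by (auto simp: PiE_iff)
  next
    fix s assume s: "s \<in> ?B"
    have "s p \<in> outputs r N (bi_spins r) (\<lambda>i. {Dolor (inv w i)}) (bi_bottoms r V) (\<lambda>l\<in>set (bi_labels r). 0) p"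
      if p: "p \<in> ?P" for p
    proof -
      have "s p \<in> ?F p" using s p by (auto dest: PiE_mem)
      moreover have "fst (s p) = Dolor (inv w (fst p))" if "Suc (snd p) = N"
        using s p that by auto
      ultimately show ?thesis by (cases p) (auto simp: outputs_def mem_Times_iff)
    qed
    then show "s \<in> ?A" using s by (auto simp: PiE_iff)
  qed
  then have "(\<Sum>w | w permutes {1..r}. \<Sum>s\<in>(\<Pi>\<^sub>E p\<in>?P.
      outputs r N (bi_spins r) (\<lambda>i. {Dolor (inv w i)}) (bi_bottoms r V) (\<lambda>l\<in>set (bi_labels r). 0) p). W s) =
    (\<Sum>w | w permutes {1..r}. \<Sum>s | s \<in> Pi\<^sub>E ?P ?F \<and> ?match w s. W s)"
    by (intro sum.cong refl) (simp only: mem_Collect_eq)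
  also have "\<dots> = (\<Sum>s\<in>Pi\<^sub>E ?P ?F. \<Sum>w | w \<in> {w. w permutes {1..r}} \<and> ?match w s. W s)"
    by (rule sum.swap_restrict[OF finite_permutations fin]) simp
  also have "\<dots> = (\<Sum>s\<in>Pi\<^sub>E ?P ?F. W s)"
  proof (intro sum.cong refl)
    fix s assume s: "s \<in> Pi\<^sub>E ?P ?F"
    show "(\<Sum>w | w \<in> {w. w permutes {1..r}} \<and> ?match w s. W s) = W s"
    proof (cases "W s = 0")
      case False
      \<comment> \<open>The value at a color is a placeholder, as the left boundary consists of
        dolors.\<close>
      define f where "f = (\<lambda>i. case fst (s (i, N - 1)) of Dolor d \<Rightarrow> d | Color c \<Rightarrow> 0)"
      have f: "fst (s (i, N - 1)) = Dolor (f i) \<and> f i \<in> {1..r}" if "i \<in> {1..r}" for i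
      proof -
        have "(i, N - 1) \<in> ?P" using that rN by simp
        from PiE_mem[OF s this] have "fst (s (i, N - 1)) \<in> Dolor ` {1..r}"
          using rN by (auto simp: outputs_def)
        then show ?thesis by (auto simp: f_def)
      qed
      have "card {i \<in> {1..r}. f i = d} = 1" if "d \<in> {1..r}" for d
      proof -
        have "{i \<in> {1..r}. f i = d} = {i \<in> {1..r}. fst (s (i, N - 1)) = Dolor d}"
          using f by (intro Collect_cong) (metis bi_spin.inject(2))
        then show ?thesis using card_left_dolors[OF rN s False[unfolded W_def] that] T[OF that] by simp
      qed
      then have "\<exists>!w. w permutes {1..r} \<and> (\<forall>i\<in>{1..r}. inv w i = f i)"
        by (intro ex1_permutation Pi_I conjunct2[OF f]) auto
      then obtain w where w: "\<And>w'. w' permutes {1..r} \<and> (\<forall>i\<in>{1..r}. inv w' i = f i) \<longleftrightarrow> w' = w"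
        unfolding Ex1_def by metis
      have "?match w' s \<longleftrightarrow> (\<forall>i\<in>{1..r}. inv w' i = f i)" for w'
        using f by (metis bi_spin.inject(2))
      then have "{w. w \<in> {w. w permutes {1..r}} \<and> ?match w s} = {w}"
        unfolding mem_Collect_eq by (simp only: w) simp
      then show ?thesis by simp
    qed simp
  qed
  finally show ?thesis .
qed

section \<open>Boundary data of the two systems and the scaling factor\<close>

theorem corollary6p3:
  fixes t :: "'a::field" and z :: "nat \<Rightarrow> 'a"
    and r N :: nat and lam w1 w3 w4 :: "nat \<Rightarrow> nat"
  assumes "r \<ge> 1" and "N \<ge> 1"
    and "antimono_on {1..r} lam" and "lam 1 < N"
    and "w1 permutes {1..r}" and "w3 permutes {1..r}" and "w4 permutes {1..r}"
    and "\<forall>i\<in>{1..r}. z i \<noteq> 0"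
  shows "col_Z t r N lam w1 w3 z =
    (\<Sum>w2 | w2 permutes {1..r}. bi_scaled_Z t r N lam w1 w2 w3 w4 z)"
proof -
  define dolor where "dolor = (\<lambda>i. inv w4 (long_element r i))"
  define Tb where "Tb = (\<lambda>j (c, d). card {i \<in> {1..r}. lam i = j \<and> inv w3 i = c \<and> dolor i = d})"
  define Tc where "Tc = (\<lambda>j c. card {i \<in> {1..r}. lam i = j \<and> inv w3 i = c})"
  \<comment> \<open>A bicolored multiplicity is at most \<open>2 * r\<close>, namely
    \<open>r\<close> on the top boundary plus one per row, and merging adds up \<open>r\<close> of
    them.\<close>
  define V where "V = {B \<in> extensional {1..r}. \<forall>c\<in>{1..r}. B c \<le> 2 * r * r}"
  let ?P = "{1..r} \<times> {..<N}" and ?L = "set (bi_labels r)"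
  have w: "inv w1 i \<in> {1..r}" "inv w3 i \<in> {1..r}" "inv w4 i \<in> {1..r}" if "i \<in> {1..r}" for i
    using that by (simp_all only: assms(5-7)[THEN permutes_inv, THEN permutes_in_image])
  have w0: "long_element r i \<in> {1..r}" if "i \<in> {1..r}" for i
    using that by (auto simp: long_element_def)
  have dolor: "dolor i \<in> {1..r}" if "i \<in> {1..r}" for i
    unfolding dolor_def by (intro w(3) w0 that)
  have inj: "inj_on dolor {1..r}"
  proof (rule inj_onI)
    fix i j assume ij: "i \<in> {1..r}" "j \<in> {1..r}" "dolor i = dolor j"
    then have "long_element r i = long_element r j"
      using permutes_inj[OF permutes_inv[OF assms(7)]] by (auto simp: dolor_def dest: injD)
    with ij show "i = j" by (auto simp: long_element_def)
  qed
  have lam: "lam i < N" if "i \<in> {1..r}" for i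
    using monotone_onD[OF assms(3), of 1 i] assms(1,4) that by auto
  \<comment> \<open>Merging forgets the dolors of the top bosons, so \<open>w4\<close> drops
    out.\<close>
  have top: "merge_bottom r (restrict (Tb j) ?L) = restrict (Tc j) (set [1..<Suc r])" for j
  proof -
    have "(\<Sum>d=1..r. Tb j (c, d)) = Tc j c" for c
    proof -
      let ?A = "{i \<in> {1..r}. lam i = j \<and> inv w3 i = c}"
      have "(\<Sum>d=1..r. Tb j (c, d)) = (\<Sum>d=1..r. card {i \<in> ?A. dolor i = d})"
        unfolding Tb_def prod.case by (intro sum.cong refl arg_cong[where f = card]) auto
      also have "\<dots> = card ?A" by (intro sum_card_fibers image_subsetI dolor) simp_all
      finally show ?thesis by (simp add: Tc_def)
    qed
    moreover have "set [1..<Suc r] = {1..r}" by auto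
    ultimately show ?thesis
      by (intro extensionalityI[of _ "{1..r}"]) (auto simp: merge_bottom_def set_bi_labels simp del: upt_Suc)
  qed
  \<comment> \<open>As \<open>dolor\<close> permutes \<open>{1..r}\<close>, each dolor occurs on the
    top boundary exactly once.\<close>
  have one: "(\<Sum>j<N. \<Sum>c=1..r. restrict (Tb j) ?L (c, d)) = 1" if d: "d \<in> {1..r}" for d
  proof -
    let ?A = "{i \<in> {1..r}. dolor i = d}"
    have "(\<Sum>j<N. \<Sum>c=1..r. restrict (Tb j) ?L (c, d)) =
        (\<Sum>j<N. \<Sum>c=1..r. card {i \<in> {i \<in> ?A. lam i = j}. inv w3 i = c})"
      using d by (intro sum.cong refl) (auto simp: Tb_def set_bi_labels intro!: arg_cong[where f = card])
    also have "\<dots> = (\<Sum>j<N. card {i \<in> ?A. lam i = j})"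
      by (intro sum.cong refl sum_card_fibers image_subsetI w(2)) simp_all
    also have "\<dots> = card ?A"
      by (intro sum_card_fibers image_subsetI lessThan_iff[THEN iffD2] lam) simp_all
    also have "\<dots> = 1"
    proof -
      have "dolor ` {1..r} = {1..r}" by (intro endo_inj_surj image_subsetI dolor inj) simp_all
      with d obtain i where i: "i \<in> {1..r}" "dolor i = d" by (metis imageE)
      then have "?A = {i}" using inj by (auto dest: inj_onD)
      then show ?thesis by simp
    qed
    finally show ?thesis .
  qed
  have card_le: "card {i \<in> {1..r}. Q i} \<le> r" for Q
  proof -
    have "{i \<in> {1..r}. Q i} \<subseteq> {1..r}" by blast
    from card_mono[OF _ this] show ?thesis by simp
  qed
  have V: "finite V" "V \<subseteq> extensional {1..r}"
  proof -
    have "V \<subseteq> (\<Pi>\<^sub>E c\<in>{1..r}. {..2 * r * r})" by (auto simp: V_def PiE_def)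
    then show "finite V" by (rule finite_subset) (auto intro: finite_PiE)
  qed (auto simp: V_def)
  interpret bi: charged_weights "bi_unfused t" "bi_spins r" fst bi_charge by (rule bi_charged_weights)
  interpret col: charged_weights "col_unfused t" "col_spins r" "\<lambda>c. c" col_charge by (rule col_charged_weights)
  let ?W = "grid_weight (bi_unfused t) (bi_labels r) (bi_spins r) r N z (\<lambda>i. Color (inv w1 i)) (\<lambda>j. restrict (Tb j) ?L)"
  have bi_Z: "bi_Z t r N lam w1 w2 w3 w4 z = (\<Sum>s\<in>(\<Pi>\<^sub>E p\<in>?P.
      outputs r N (bi_spins r) (\<lambda>i. {Dolor (inv w2 i)}) (bi_bottoms r V) (\<lambda>l\<in>?L. 0) p). ?W s)"
    if w2: "w2 permutes {1..r}" for w2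
  proof -
    have "bi_Z t r N lam w1 w2 w3 w4 z = partition_function (bi_unfused t) (bi_labels r) (bi_spins r) r N z
        (\<lambda>i. Dolor (inv w2 i)) (\<lambda>i. Color (inv w1 i)) Tb"
      by (simp only: bi_Z_def Tb_def dolor_def)
    also have "\<dots> = (\<Sum>s\<in>(\<Pi>\<^sub>E p\<in>?P.
      outputs r N (bi_spins r) (\<lambda>i. {Dolor (inv w2 i)}) (bi_bottoms r V) (\<lambda>l\<in>?L. 0) p). ?W s)"
    proof (rule bi.partition_function_eq[where M = "2 * r"])
      show "B \<in> bi_bottoms r V" if B: "B \<in> extensional ?L" "\<And>l. l \<in> ?L \<Longrightarrow> B l \<le> 2 * r" for B
      proof -
        have "(\<Sum>d=1..r. B (c, d)) \<le> 2 * r * r" if "c \<in> {1..r}" for c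
          using sum_bounded_above[of "{1..r}" "\<lambda>d. B (c, d)" "2 * r"] that B(2)
          by (simp add: set_bi_labels mult.commute)
        then show ?thesis using B(1) by (simp add: bi_bottoms_def V_def merge_bottom_def)
      qed
      show "Dolor (inv w2 i) \<in> bi_spins r" if "i \<in> {1..r}" for i
        using permutes_in_image[OF permutes_inv[OF w2], of i] that by blast
      show "Color (inv w1 i) \<in> bi_spins r" if "i \<in> {1..r}" for i using w(1)[OF that] by blast
      show "Tb j l + r \<le> 2 * r" for j l using card_le by (cases l) (simp add: Tb_def)
    qed (use assms(1,2) finite_bi_bottoms[OF V(1)] in \<open>auto simp only: bi_bottoms_def\<close>)
    finally show ?thesis .
  qed
  have set: "set [1..<Suc r] = {1..r}" by auto
  have col_Z: "col_Z t r N lam w1 w3 z = (\<Sum>s\<in>Pi\<^sub>E ?P (col_outputs r N V).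
      grid_weight (col_unfused t) [1..<Suc r] (col_spins r) r N z (\<lambda>i. Particle (inv w1 i))
        (\<lambda>j. restrict (Tc j) (set [1..<Suc r])) s)"
  proof -
    have "col_Z t r N lam w1 w3 z = partition_function (col_unfused t) [1..<Suc r] (col_spins r) r N z
        (\<lambda>i. Plus) (\<lambda>i. Particle (inv w1 i)) Tc"
      by (simp only: col_Z_def Tc_def)
    also have "\<dots> = (\<Sum>s\<in>(\<Pi>\<^sub>E p\<in>?P. outputs r N (col_spins r) (\<lambda>i. {Plus}) V (\<lambda>c\<in>set [1..<Suc r]. 0) p).
      grid_weight (col_unfused t) [1..<Suc r] (col_spins r) r N z (\<lambda>i. Particle (inv w1 i))
        (\<lambda>j. restrict (Tc j) (set [1..<Suc r])) s)"
    \<comment> \<open>The bound of the merged bicolored configurations is used again, to have the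
      same \<open>V\<close> in both models.\<close>
    proof (rule col.partition_function_eq[where M = "2 * r * r"])
      show "Particle (inv w1 i) \<in> col_spins r" if "i \<in> {1..r}" for i using w(1)[OF that] by blast
      show "Tc j l + r \<le> 2 * r * r" for j l
      proof -
        have "Tc j l \<le> r" unfolding Tc_def by (rule card_le)
        moreover have "r \<le> r * r" by simp
        ultimately show ?thesis by linarith
      qed
      show "V \<subseteq> extensional (set [1..<Suc r])" using V(2) by (simp only: set)
      show "B \<in> V" if "B \<in> extensional (set [1..<Suc r])" "\<And>l. l \<in> set [1..<Suc r] \<Longrightarrow> B l \<le> 2 * r * r" for B
        using that unfolding V_def set by blast
    qed (use assms(1,2) V(1) in auto)
    finally show ?thesis by (simp only: set)
  qed
  have "(\<Sum>w2 | w2 permutes {1..r}. bi_Z t r N lam w1 w2 w3 w4 z) =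
      (\<Sum>w2 | w2 permutes {1..r}. \<Sum>s\<in>(\<Pi>\<^sub>E p\<in>?P.
        outputs r N (bi_spins r) (\<lambda>i. {Dolor (inv w2 i)}) (bi_bottoms r V) (\<lambda>l\<in>?L. 0) p). ?W s)"
    by (intro sum.cong refl bi_Z) (simp only: mem_Collect_eq)
  also have "\<dots> = (\<Sum>s\<in>Pi\<^sub>E ?P (bi_outputs r N V). ?W s)"
    by (rule sum_left_permutations[OF assms(1,2) V(1) one])
  also have "\<dots> = (\<Prod>p\<in>?P. z (fst p) ^ (r - 1)) *
      (\<Sum>s\<in>Pi\<^sub>E ?P (col_outputs r N V). grid_weight (col_unfused t) [1..<Suc r] (col_spins r) r N z
        (\<lambda>i. merge (Color (inv w1 i))) (\<lambda>j. merge_bottom r (restrict (Tb j) ?L)) s)"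
  proof (rule sum_grid_weight_bi[OF _ _ V])
    show "Color (inv w1 i) \<in> bi_spins r" if "i \<in> {1..r}" for i using w(1)[OF that] by blast
    show "z i \<noteq> 0" if "i \<in> {1..r}" for i using assms(8) that by blast
  qed
  also have "\<dots> = (\<Prod>p\<in>?P. z (fst p) ^ (r - 1)) * col_Z t r N lam w1 w3 z"
    by (simp only: col_Z merge.simps top)
  finally have total: "(\<Sum>w2 | w2 permutes {1..r}. bi_Z t r N lam w1 w2 w3 w4 z) =
      (\<Prod>p\<in>?P. z (fst p) ^ (r - 1)) * col_Z t r N lam w1 w3 z" .
  have powers: "(\<Prod>p\<in>?P. z (fst p) ^ (r - 1)) = (\<Prod>i=1..r. z i ^ (N * (r - 1)))"
  proof -
    have "(\<Prod>p\<in>?P. z (fst p) ^ (r - 1)) = (\<Prod>i=1..r. \<Prod>j<N. z i ^ (r - 1))"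
      by (simp only: prod.cartesian_product case_prod_unfold)
    then show ?thesis by (simp add: mult.commute flip: power_mult)
  qed
  \<comment> \<open>Each of the \<open>N\<close> vertices of row \<open>i\<close> contributed
    \<open>z i ^ (r - 1)\<close>, which the scaling exponent \<open>N * (1 - r)\<close> removes
    since \<open>z i\<close> is nonzero.\<close>
  have cancel: "(\<Prod>i=1..r. z i powi (int N * (1 - int r))) * (\<Prod>i=1..r. z i ^ (N * (r - 1))) = 1"
    unfolding prod.distrib[symmetric]
  proof (intro prod.neutral ballI)
    fix i assume "i \<in> {1..r}"
    then have "z i \<noteq> 0" using assms(8) by blast
    moreover have "int N * (1 - int r) = - int (N * (r - 1))"
      using assms(1) by (simp add: of_nat_diff algebra_simps)
    then have "z i powi (int N * (1 - int r)) = inverse (z i ^ (N * (r - 1)))"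
      by (simp only: power_int_minus power_int_of_nat)
    ultimately show "z i powi (int N * (1 - int r)) * z i ^ (N * (r - 1)) = 1" by simp
  qed
  have "col_Z t r N lam w1 w3 z = (\<Prod>i=1..r. z i powi (int N * (1 - int r))) *
      (\<Sum>w2 | w2 permutes {1..r}. bi_Z t r N lam w1 w2 w3 w4 z)"
    by (simp only: total powers cancel mult.assoc[symmetric] mult_1)
  then show ?thesis by (simp only: bi_scaled_Z_def sum_distrib_left)
qed

end
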